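(* Hyperplanes $A^\perp$ and $B^\perp$ in $\mathcal{P}(n)$ ($A,B\in Sym_n(\mathbb{R})$) are disjoint if and only if either of the following holds, up to a congruence transformation of $(A,B)$: (1) The matrix pencil $(A,B)$ is diagonal (both matrices are diagonal) and semi-definite. (2) The matrix pencil $(A,B)$ is block-diagonal, where the blocks are at most $2$-dimensional. Moreover, all blocks $(A_i,B_i)$ of dimension $2$ share the same generalized eigenvalue $\lambda$, while $A-\lambda B$ is (nonzero) semi-definite.
   Context: $Sym_n(\mathbb{R})$ is the space of real symmetric $n\times n$ matrices; $\mathcal{P}(n)=\{X\in Sym_n(\mathbb{R}):\det X=1,\ X>0\}$. For nonzero $A\in Sym_n(\mathbb{R})$, $A^\perp=\{X\in\mathcal{P}(n):\mathrm{tr}(XA)=0\}$; it is called a hyperplane when it is non-empty. A congruence transformation of $(A,B)$ is $(A,B)\mapsto(Q^TAQ,Q^TBQ)$ with $Q\in GL(n,\mathbb{R})$. A pencil $(A,B)$ is block-diagonal if $A=\mathrm{diag}(A_1,\dots,A_m)$, $B=\mathrm{diag}(B_1,\dots,B_m)$ with $A_i,B_i$ square of the same dimension $d_i$; the $(A_i,B_i)$ are its blocks. A generalized eigenvalue of a pencil $(A,B)$ is a number $\lambda_0$ with $A-\lambda_0B$ singular. A matrix is semi-definite if it is positive or negative semi-definite. The symmetric pencil $(A,B)$ is semi-definite if some linear combination $c_1A+c_2B$ with $c_1,c_2\in\mathbb{R}$ is a nonzero positive semi-definite matrix. *)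

theory Defs
  imports Complex_Main "Jordan_Normal_Form.Matrix" "Jordan_Normal_Form.Determinant"
begin

definition trace_mat :: "real mat \<Rightarrow> real" where
  "trace_mat A = (\<Sum>i<dim_row A. A $$ (i, i))"

definition Sym :: "nat \<Rightarrow> real mat set" where
  "Sym n = {A \<in> carrier_mat n n. transpose_mat A = A}"

definition pos_def :: "nat \<Rightarrow> real mat \<Rightarrow> bool" where
  "pos_def n A \<longleftrightarrow> A \<in> Sym n \<and> (\<forall>v \<in> carrier_vec n. v \<noteq> 0\<^sub>v n \<longrightarrow> v \<bullet> (A *\<^sub>v v) > 0)"

definition pos_semidef :: "nat \<Rightarrow> real mat \<Rightarrow> bool" where
  "pos_semidef n A \<longleftrightarrow> A \<in> Sym n \<and> (\<forall>v \<in> carrier_vec n. v \<bullet> (A *\<^sub>v v) \<ge> 0)"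

definition semidef :: "nat \<Rightarrow> real mat \<Rightarrow> bool" where
  "semidef n A \<longleftrightarrow> pos_semidef n A \<or> pos_semidef n (- A)"

definition P_space :: "nat \<Rightarrow> real mat set" where
  "P_space n = {X \<in> Sym n. det X = 1 \<and> pos_def n X}"

definition perp :: "nat \<Rightarrow> real mat \<Rightarrow> real mat set" where
  "perp n A = {X \<in> P_space n. trace_mat (X * A) = 0}"

definition is_hyperplane :: "nat \<Rightarrow> real mat \<Rightarrow> bool" where
  "is_hyperplane n A \<longleftrightarrow> A \<in> Sym n \<and> A \<noteq> 0\<^sub>m n n \<and> perp n A \<noteq> {}"

definition congruent_pencil ::
    "nat \<Rightarrow> real mat \<Rightarrow> real mat \<Rightarrow> real mat \<Rightarrow> real mat \<Rightarrow> bool" where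
  "congruent_pencil n A B A' B' \<longleftrightarrow>
     (\<exists>Q \<in> carrier_mat n n. invertible_mat Q \<and>
        A' = transpose_mat Q * A * Q \<and> B' = transpose_mat Q * B * Q)"

definition semidef_pencil :: "nat \<Rightarrow> real mat \<Rightarrow> real mat \<Rightarrow> bool" where
  "semidef_pencil n A B \<longleftrightarrow>
     (\<exists>c1 c2 :: real. c1 \<cdot>\<^sub>m A + c2 \<cdot>\<^sub>m B \<noteq> 0\<^sub>m n n \<and> pos_semidef n (c1 \<cdot>\<^sub>m A + c2 \<cdot>\<^sub>m B))"

text \<open>The list holds the blocks \<open>(A\<^sub>i, B\<^sub>i)\<close>; each is square and of positive dimension.\<close>

definition block_diagonal_pencil ::
    "real mat \<Rightarrow> real mat \<Rightarrow> (real mat \<times> real mat) list \<Rightarrow> bool" where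
  "block_diagonal_pencil A B bs \<longleftrightarrow>
     (\<forall>(C, D) \<in> set bs. \<exists>d>0. C \<in> carrier_mat d d \<and> D \<in> carrier_mat d d) \<and>
     A = diag_block_mat (map fst bs) \<and> B = diag_block_mat (map snd bs)"

text \<open>Real eigenvalues only: the value of interest makes \<open>A - \<lambda>B\<close> semi-definite.\<close>

definition gen_eigenvalue :: "real mat \<Rightarrow> real mat \<Rightarrow> real \<Rightarrow> bool" where
  "gen_eigenvalue A B l \<longleftrightarrow> \<not> invertible_mat (A - l \<cdot>\<^sub>m B)"

end

(* Writing X > 0 for positive definite X, the image of the cone {X > 0} under
   X |-> (tr XA, tr XB) is a convex cone in the plane, and rescaling to det X = 1 is harmless.
   So the hyperplanes are disjoint iff this cone misses the origin, and separation in the plane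
   together with self-duality of the positive semi-definite cone makes this equivalent to
   some S = c1 A + c2 B being nonzero and positive semi-definite, a property invariant under
   congruence. As B^perp is non-empty, c1 is nonzero, so A = s S + l B with s nonzero, and it is
   enough to block-diagonalise (S, B). This is done by splitting off one block at a time, looking at
   K = ker S: a vector v of K with v.Bv nonzero splits off (its B-orthogonal complement is a
   common complement), and so does a common kernel vector. If B vanishes on K but Bv is nonzero for
   some v in K, then Bv is orthogonal to K, hence Bv = Su for some u, and the plane spanned by
   u and v splits off with S singular on it. If K = 0, a generalized eigenvector Bv = mu Sv splits off.
   In particular disjoint hyperplanes always have form (2). *)

theory Submission
  imports "HOL-Analysis.Convex_Euclidean_Space" "Jordan_Normal_Form.Spectral_Radius" Defs
begin

unbundle no inner_syntax

section \<open>Congruence and semi-definiteness\<close>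

lemma SymD: "A \<in> Sym n \<Longrightarrow> A \<in> carrier_mat n n" "A \<in> Sym n \<Longrightarrow> transpose_mat A = A"
  by (auto simp: Sym_def)

lemma Sym_index: "A \<in> Sym n \<Longrightarrow> i < n \<Longrightarrow> j < n \<Longrightarrow> A $$ (i, j) = A $$ (j, i)"
  by (metis SymD carrier_matD index_transpose_mat(1))

lemma SymI:
  assumes "A \<in> carrier_mat n n" "\<And>i j. i < n \<Longrightarrow> j < n \<Longrightarrow> A $$ (i, j) = A $$ (j, i)"
  shows "A \<in> Sym n"
  using assms by (auto simp: Sym_def intro!: eq_matI)

text \<open>Bridge from the \<open>invertible_mat\<close> of the definitions to nonzero
  determinants, the form in which invertibility is handled below.\<close>

lemma invertible_mat_iff_det:
  fixes A :: "'a :: field mat"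
  assumes A: "A \<in> carrier_mat n n"
  shows "invertible_mat A \<longleftrightarrow> det A \<noteq> 0"
proof
  assume "invertible_mat A"
  then obtain B where B: "A * B = 1\<^sub>m n" "B * A = 1\<^sub>m (dim_row B)"
    using A unfolding invertible_mat_def inverts_mat_def by auto
  \<comment> \<open>The notion \<open>invertible_mat\<close> leaves the shape of \<open>B\<close>
    open; it is read off the two identity matrices.\<close>
  have "dim_row B = n" using arg_cong[OF B(2), of dim_col] A by auto
  moreover have "dim_col B = n" using arg_cong[OF B(1), of dim_col] A by auto
  ultimately have "B \<in> carrier_mat n n" by auto
  from det_mult[OF A this] B(1) show "det A \<noteq> 0" by auto
next
  assume "det A \<noteq> 0"
  \<comment> \<open>\<open>undefined\<close> fills the extension slot of the record
    \<open>ring_mat\<close>.\<close>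
  from det_non_zero_imp_unit[OF A this, of undefined]
  obtain B where "B \<in> carrier_mat n n" "A * B = 1\<^sub>m n" "B * A = 1\<^sub>m n"
    unfolding Units_def ring_mat_def by auto
  with A show "invertible_mat A" unfolding invertible_mat_def inverts_mat_def by auto
qed

lemma obtain_inverse_mat:
  fixes Q :: "'a :: field mat"
  assumes Q: "Q \<in> carrier_mat n n" "det Q \<noteq> 0"
  obtains R where "R \<in> carrier_mat n n" "Q * R = 1\<^sub>m n" "R * Q = 1\<^sub>m n" "det R \<noteq> 0"
proof -
  from det_non_zero_imp_unit[OF Q, of undefined]
  obtain R where R: "R \<in> carrier_mat n n" "Q * R = 1\<^sub>m n" "R * Q = 1\<^sub>m n"
    unfolding Units_def ring_mat_def by auto
  moreover have "det R \<noteq> 0" using det_mult[OF Q(1) R(1)] R(2) by auto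
  ultimately show ?thesis using that by blast
qed

section \<open>Congruence as a change of basis\<close>

definition congr :: "real mat \<Rightarrow> real mat \<Rightarrow> real mat" where
  "congr Q A = transpose_mat Q * A * Q"

lemma congr_carrier [simp, intro]:
  "Q \<in> carrier_mat n n \<Longrightarrow> A \<in> carrier_mat n n \<Longrightarrow> congr Q A \<in> carrier_mat n n"
  unfolding congr_def by auto

lemma congr_dim [simp]:
  "Q \<in> carrier_mat n n \<Longrightarrow> dim_row (congr Q A) = n"
  "Q \<in> carrier_mat n n \<Longrightarrow> dim_col (congr Q A) = n"
  unfolding congr_def by auto

lemma congr_one [simp]: "A \<in> carrier_mat n n \<Longrightarrow> congr (1\<^sub>m n) A = A"
  unfolding congr_def by auto

lemma congr_mult:
  assumes "Q \<in> carrier_mat n n" "R \<in> carrier_mat n n" "A \<in> carrier_mat n n"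
  shows "congr R (congr Q A) = congr (Q * R) A"
proof -
  have "transpose_mat (Q * R) = transpose_mat R * transpose_mat Q"
    using assms by (simp add: transpose_mult)
  then show ?thesis
    unfolding congr_def using assms
    by (smt (verit, ccfv_threshold) assoc_mult_mat mult_carrier_mat transpose_carrier_mat)
qed

lemma congr_mult_vec:
  assumes "Q \<in> carrier_mat n n" "A \<in> carrier_mat n n" "v \<in> carrier_vec n"
  shows "congr Q A *\<^sub>v v = transpose_mat Q *\<^sub>v (A *\<^sub>v (Q *\<^sub>v v))"
proof -
  have "congr Q A *\<^sub>v v = (transpose_mat Q * A) *\<^sub>v (Q *\<^sub>v v)"
    unfolding congr_def using assms by (intro assoc_mult_mat_vec) auto
  also have "\<dots> = transpose_mat Q *\<^sub>v (A *\<^sub>v (Q *\<^sub>v v))"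
    using assms by (intro assoc_mult_mat_vec) auto
  finally show ?thesis .
qed

text \<open>\<open>congr Q A\<close> is the bilinear form of \<open>A\<close> in the basis formed by
  the columns of \<open>Q\<close>; positivity is transferred through this identity.\<close>

lemma scalar_congr_mult_vec:
  assumes "Q \<in> carrier_mat n n" "A \<in> carrier_mat n n" "v \<in> carrier_vec n" "w \<in> carrier_vec n"
  shows "w \<bullet> (congr Q A *\<^sub>v v) = (Q *\<^sub>v w) \<bullet> (A *\<^sub>v (Q *\<^sub>v v))"
proof -
  have T: "transpose_mat Q \<in> carrier_mat n n" using assms by auto
  have "(transpose_mat (transpose_mat Q) *\<^sub>v w) \<bullet> (A *\<^sub>v (Q *\<^sub>v v))
      = w \<bullet> (transpose_mat Q *\<^sub>v (A *\<^sub>v (Q *\<^sub>v v)))"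
    using assms by (intro transpose_vec_mult_scalar[OF T]) auto
  then show ?thesis using congr_mult_vec[OF assms(1-3)] by simp
qed

lemma congr_Sym: "Q \<in> carrier_mat n n \<Longrightarrow> A \<in> Sym n \<Longrightarrow> congr Q A \<in> Sym n"
  unfolding congr_def Sym_def by (auto simp: transpose_mult[of _ n n _ n] assoc_mult_mat[of _ n n _ n _ n])

lemma congr_zero [simp]: "Q \<in> carrier_mat n n \<Longrightarrow> congr Q (0\<^sub>m n n) = 0\<^sub>m n n"
  unfolding congr_def by auto

lemma congr_add:
  assumes "Q \<in> carrier_mat n n" "A \<in> carrier_mat n n" "B \<in> carrier_mat n n"
  shows "congr Q (A + B) = congr Q A + congr Q B"
  unfolding congr_def using assms
  by (simp add: mult_add_distrib_mat[of _ n n] add_mult_distrib_mat[of _ n n])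

lemma congr_smult:
  assumes "Q \<in> carrier_mat n n" "A \<in> carrier_mat n n"
  shows "congr Q (c \<cdot>\<^sub>m A) = c \<cdot>\<^sub>m congr Q A"
  unfolding congr_def using assms
  by (simp add: mult_smult_distrib[of _ n n] mult_smult_assoc_mat[of _ n n])

text \<open>Congruence by an inverse of \<open>Q\<close> undoes congruence by \<open>Q\<close>, and
  every congruence fixes zero.\<close>

lemma congr_eq_zeroD:
  assumes "Q \<in> carrier_mat n n" "det Q \<noteq> 0" "A \<in> carrier_mat n n" "congr Q A = 0\<^sub>m n n"
  shows "A = 0\<^sub>m n n"
proof -
  obtain R where R: "R \<in> carrier_mat n n" "Q * R = 1\<^sub>m n"
    using obtain_inverse_mat[OF assms(1,2)] by metis
  have "A = congr R (congr Q A)"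
    using assms(1-3) R by (simp add: congr_mult[of _ n])
  also have "\<dots> = 0\<^sub>m n n" using assms(4) R(1) by simp
  finally show ?thesis .
qed

lemma congr_pos_semidef:
  "Q \<in> carrier_mat n n \<Longrightarrow> pos_semidef n A \<Longrightarrow> pos_semidef n (congr Q A)"
  unfolding pos_semidef_def by (auto simp: congr_Sym scalar_congr_mult_vec SymD)

lemma congr_pos_semidef_iff:
  assumes "Q \<in> carrier_mat n n" "det Q \<noteq> 0" "A \<in> carrier_mat n n"
  shows "pos_semidef n (congr Q A) \<longleftrightarrow> pos_semidef n A"
proof
  obtain R where R: "R \<in> carrier_mat n n" "Q * R = 1\<^sub>m n"
    using obtain_inverse_mat[OF assms(1,2)] by metis
  assume "pos_semidef n (congr Q A)"
  then have "pos_semidef n (congr R (congr Q A))" using R(1) by (rule congr_pos_semidef[rotated])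
  then show "pos_semidef n A" using assms R by (simp add: congr_mult[of _ n])
qed (rule congr_pos_semidef[OF assms(1)])

lemma mult_mat_vec_nonzero:
  fixes Q :: "'a :: field mat"
  assumes "Q \<in> carrier_mat n n" "det Q \<noteq> 0" "v \<in> carrier_vec n" "v \<noteq> 0\<^sub>v n"
  shows "Q *\<^sub>v v \<noteq> 0\<^sub>v n"
  using det_0_iff_vec_prod_zero[OF assms(1)] assms by auto

section \<open>Quadratic forms of symmetric matrices\<close>

lemma scalar_Sym_comm:
  assumes "A \<in> Sym n" "v \<in> carrier_vec n" "w \<in> carrier_vec n"
  shows "v \<bullet> (A *\<^sub>v w) = w \<bullet> (A *\<^sub>v v)"
  by (smt (verit) SymD assms comm_scalar_prod mult_mat_vec_carrier transpose_vec_mult_scalar)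

lemma scalar_prod_self_eq_0_iff:
  fixes v :: "real vec"
  assumes "v \<in> carrier_vec n"
  shows "v \<bullet> v = 0 \<longleftrightarrow> v = 0\<^sub>v n"
  using assms by (auto simp: scalar_prod_def sum_nonneg_eq_0_iff)

lemma scalar_prod_self_pos:
  fixes v :: "real vec"
  assumes "v \<in> carrier_vec n" "v \<noteq> 0\<^sub>v n"
  shows "v \<bullet> v > 0"
proof -
  have "v \<bullet> v \<ge> 0" by (auto simp: scalar_prod_def intro: sum_nonneg)
  then show ?thesis using scalar_prod_self_eq_0_iff[OF assms(1)] assms(2) by linarith
qed

text \<open>With \<open>w = S *\<^sub>v v\<close>, the form at
  \<open>v + t \<cdot>\<^sub>v w\<close> is \<open>2 * t * b + t\<^sup>2 * c\<close> where
  \<open>b = w \<bullet> w\<close>; for \<open>b > 0\<close> the linear term would make it negative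
  at small negative \<open>t\<close>.\<close>

lemma pos_semidef_kernel:
  assumes S: "pos_semidef n S" and v: "v \<in> carrier_vec n" and 0: "v \<bullet> (S *\<^sub>v v) = 0"
  shows "S *\<^sub>v v = 0\<^sub>v n"
proof -
  have Sym: "S \<in> Sym n" and Sc: "S \<in> carrier_mat n n"
    and nn: "\<And>v. v \<in> carrier_vec n \<Longrightarrow> v \<bullet> (S *\<^sub>v v) \<ge> 0"
    using S SymD by (auto simp: pos_semidef_def)
  define w where "w = S *\<^sub>v v"
  have w: "w \<in> carrier_vec n" using Sc v by (auto simp: w_def)
  define b where "b = w \<bullet> w"
  define c where "c = w \<bullet> (S *\<^sub>v w)"
  have q: "0 \<le> 2 * t * b + t\<^sup>2 * c" for t :: real
  proof -
    have "0 \<le> (v + t \<cdot>\<^sub>v w) \<bullet> (S *\<^sub>v (v + t \<cdot>\<^sub>v w))" using v w by (intro nn) auto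
    also have "S *\<^sub>v (v + t \<cdot>\<^sub>v w) = w + t \<cdot>\<^sub>v (S *\<^sub>v w)"
      using v w Sc by (simp add: mult_add_distrib_mat_vec[of _ n n] mult_mat_vec[of _ n n] w_def)
    also have "(v + t \<cdot>\<^sub>v w) \<bullet> (w + t \<cdot>\<^sub>v (S *\<^sub>v w))
        = v \<bullet> w + t * (v \<bullet> (S *\<^sub>v w)) + t * (w \<bullet> w) + t * t * (w \<bullet> (S *\<^sub>v w))"
      using v w Sc
      by (simp add: add_scalar_prod_distrib[of _ n] scalar_prod_add_distrib[of _ n] algebra_simps)
    also have "v \<bullet> (S *\<^sub>v w) = b"
      using scalar_Sym_comm[OF Sym v w] by (simp add: b_def w_def)
    also have "v \<bullet> w = 0" using 0 by (simp add: w_def)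
    finally show ?thesis by (simp add: b_def c_def power2_eq_square)
  qed
  have b0: "b \<ge> 0" by (auto simp: b_def scalar_prod_def intro: sum_nonneg)
  have c0: "c \<ge> 0" using nn[OF w] by (simp add: c_def)
  have "b = 0"
  proof (rule ccontr)
    assume "b \<noteq> 0"
    with b0 have "b > 0" by simp
    \<comment> \<open>The minimiser would be \<open>- b / c\<close>; the added 1 keeps the
      denominator positive when \<open>c = 0\<close>, and the value is still negative.\<close>
    define t where "t = - b / (c + 1)"
    have "2 * t * b + t\<^sup>2 * c = - (b\<^sup>2 * (c + 2)) / (c + 1)\<^sup>2"
      using c0 unfolding t_def by (simp add: power2_eq_square divide_simps) (simp add: algebra_simps)
    also have "\<dots> < 0" using \<open>b > 0\<close> c0 by (auto simp: divide_neg_pos)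
    finally show False using q[of t] by simp
  qed
  then show ?thesis using scalar_prod_self_eq_0_iff[OF w] by (simp add: b_def w_def)
qed

section \<open>Splitting off blocks\<close>

lemma unit_vec_quadratic:
  fixes A :: "real mat"
  assumes "A \<in> carrier_mat n n" "i < n" "j < n"
  shows "unit_vec n i \<bullet> (A *\<^sub>v unit_vec n j) = A $$ (i, j)"
  using assms by (simp add: scalar_prod_left_unit scalar_prod_right_unit)

lemma pos_def_imp_semidef: "pos_def n A \<Longrightarrow> pos_semidef n A"
  unfolding pos_def_def pos_semidef_def
  by (metis SymD(1) less_eq_real_def mult_mat_vec_carrier scalar_prod_left_zero)

text \<open>The identity matrix with its first column replaced is lower triangular, hence invertible
  if the top entry is nonzero. Exchanging rows 0 and \<open>i\<close> brings a nonzero entry of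
  \<open>v\<close> to the top.\<close>

lemma obtain_mat_first_column:
  fixes v :: "real vec"
  assumes v: "v \<in> carrier_vec n" "v \<noteq> 0\<^sub>v n"
  obtains P where "P \<in> carrier_mat n n" "det P \<noteq> 0" "P *\<^sub>v unit_vec n 0 = v"
proof -
  obtain i where i: "i < n" "v $ i \<noteq> 0" using v by (metis carrier_vecD eq_vecI index_zero_vec)
  define \<pi> where "\<pi> r = (if r = 0 then i else if r = i then 0 else r)" for r
  define P0 where "P0 = mat n n (\<lambda>(r, c). if c = 0 then v $ \<pi> r else if r = c then 1 else 0)"
  have P0: "P0 \<in> carrier_mat n n" by (simp add: P0_def)
  have "det P0 = prod_list (diag_mat P0)"
    by (rule det_lower_triangular[OF _ P0]) (auto simp: P0_def)
  also have "\<dots> \<noteq> 0"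
    using i by (auto simp: diag_mat_def P0_def \<pi>_def prod_list_zero_iff)
  finally have d0: "det P0 \<noteq> 0" .
  define P where "P = mat n n (\<lambda>(r, c). P0 $$ (\<pi> r, c))"
  have P: "P \<in> carrier_mat n n" by (simp add: P_def)
  have \<pi>: "\<pi> r < n" if "r < n" for r using that i by (auto simp: \<pi>_def)
  have "P *\<^sub>v x \<noteq> 0\<^sub>v n" if x: "x \<in> carrier_vec n" "x \<noteq> 0\<^sub>v n" for x
  proof
    assume "P *\<^sub>v x = 0\<^sub>v n"
    then have z: "(P *\<^sub>v x) $ r = 0" if "r < n" for r using that by simp
    have "(P0 *\<^sub>v x) $ r = 0" if "r < n" for r
    proof -
      \<comment> \<open>\<open>\<pi>\<close> is an involution, so \<open>P\<close> has the rows of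
        \<open>P0\<close> in another order and therefore the same kernel.\<close>
      have "row P (\<pi> r) = row P0 r"
        using that \<pi>[OF that] P0 by (intro eq_vecI) (auto simp: P_def \<pi>_def)
      then show ?thesis using z[OF \<pi>[OF that]] that \<pi>[OF that] P P0 by simp
    qed
    then have "P0 *\<^sub>v x = 0\<^sub>v n" using P0 by (intro eq_vecI) auto
    then show False using mult_mat_vec_nonzero[OF P0 d0 x] by simp
  qed
  then have "det P \<noteq> 0" using det_0_iff_vec_prod_zero[OF P] by blast
  moreover have "P *\<^sub>v unit_vec n 0 = v"
    using v i \<pi> by (intro eq_vecI) (auto simp: P_def P0_def scalar_prod_right_unit \<pi>_def)
  ultimately show ?thesis using that P by blast
qed

text \<open>Block Gaussian elimination: the hypothesis says \<open>M\<^sub>1\<^sub>1 X = M\<^sub>1\<^sub>2\<close>. No invertibility of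
  \<open>M\<^sub>1\<^sub>1\<close> is assumed, so that one \<open>X\<close> can serve both matrices of a pencil.\<close>

lemma congr_shear:
  fixes M :: "real mat"
  assumes M: "M \<in> Sym n" and n: "n = k + m" and X: "X \<in> carrier_mat k m"
    and MX: "\<And>i j. i < k \<Longrightarrow> j < m \<Longrightarrow> (\<Sum>l<k. M $$ (i, l) * X $$ (l, j)) = M $$ (i, k + j)"
  shows "\<exists>D \<in> Sym m. congr (four_block_mat (1\<^sub>m k) (- X) (0\<^sub>m m k) (1\<^sub>m m)) M =
    four_block_mat (mat k k (\<lambda>ij. M $$ ij)) (0\<^sub>m k m) (0\<^sub>m m k) D"
proof -
  have Mc: "M \<in> carrier_mat n n" and MT: "transpose_mat M = M" using SymD[OF M] by auto
  define M1 M2 M4 where "M1 = mat k k (\<lambda>ij. M $$ ij)"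
    and "M2 = mat k m (\<lambda>(i, j). M $$ (i, k + j))"
    and "M4 = mat m m (\<lambda>(i, j). M $$ (k + i, k + j))"
  note defs = M1_def M2_def M4_def
  have c: "M1 \<in> carrier_mat k k" "M2 \<in> carrier_mat k m" "M4 \<in> carrier_mat m m"
    "transpose_mat M2 \<in> carrier_mat m k" "transpose_mat X \<in> carrier_mat m k"
    using X by (auto simp: defs)
  have M1T: "transpose_mat M1 = M1" and M4T: "transpose_mat M4 = M4"
    using Sym_index[OF M] n by (auto simp: defs intro!: eq_matI)
  have M: "M = four_block_mat M1 M2 (transpose_mat M2) M4"
    using Mc n Sym_index[OF M] by (intro eq_matI) (auto simp: defs)
  have M1X: "M1 * X = M2"
    using X MX by (intro eq_matI) (auto simp: defs scalar_prod_def atLeast0LessThan)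
  have XM1: "transpose_mat X * M1 = transpose_mat M2"
    using transpose_mult[OF c(1) X] M1X M1T by simp
  define Q where "Q = four_block_mat (1\<^sub>m k) (- X) (0\<^sub>m m k) (1\<^sub>m m)"
  have QT: "transpose_mat Q = four_block_mat (1\<^sub>m k) (0\<^sub>m k m) (- transpose_mat X) (1\<^sub>m m)"
    unfolding Q_def using X by (subst transpose_four_block_mat[of _ k k _ m _ m])
      (auto simp: transpose_uminus)
  \<comment> \<open>The Schur complement: since \<open>M2 = M1 * X\<close>, the subtracted term is
    \<open>transpose_mat X * M1 * X\<close>, which also explains why \<open>D\<close> is
    symmetric.\<close>
  define D where "D = - transpose_mat X * M2 + M4"
  have D: "D \<in> carrier_mat m m" using c by (auto simp: D_def)
  have "transpose_mat Q * M = four_block_mat M1 M2 (0\<^sub>m m k) D"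
    unfolding QT M using c X XM1
    by (subst mult_four_block_mat[of _ k k _ m _ m]) (auto simp: D_def)
  then have "congr Q M = four_block_mat M1 M2 (0\<^sub>m m k) D * Q"
    by (simp add: congr_def)
  also have "\<dots> = four_block_mat (M1 * 1\<^sub>m k + M2 * 0\<^sub>m m k) (M1 * (- X) + M2 * 1\<^sub>m m)
      (0\<^sub>m m k * 1\<^sub>m k + D * 0\<^sub>m m k) (0\<^sub>m m k * (- X) + D * 1\<^sub>m m)"
    unfolding Q_def by (rule mult_four_block_mat) (use c X D in auto)
  also have "M1 * (- X) = - M2" using c X M1X by (simp add: uminus_mult_right_mat)
  also have "- M2 + M2 * 1\<^sub>m m = 0\<^sub>m k m" using c(2) by (intro eq_matI) auto
  finally have "congr Q M = four_block_mat M1 (0\<^sub>m k m) (0\<^sub>m m k) D"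
    using c X D by auto
  moreover have "D \<in> Sym m"
  proof -
    have "transpose_mat X * M2 = transpose_mat X * (M1 * X)" by (simp add: M1X)
    also have "\<dots> = transpose_mat M2 * X" using XM1 c X by (simp add: assoc_mult_mat[of _ m k _ k _ m, symmetric])
    finally have "transpose_mat (transpose_mat X * M2) = transpose_mat X * M2"
      using X c by (simp add: transpose_mult[of _ m k _ m])
    then show ?thesis
      unfolding Sym_def D_def using c X M4T
      by (auto simp: transpose_add[of _ m m] transpose_uminus)
  qed
  ultimately show ?thesis unfolding Q_def M1_def by blast
qed

text \<open>For the inductions: a reduction found for the lower block extends to the whole matrix
  without disturbing the block already split off.\<close>

lemma congr_block_diag:
  assumes "C \<in> carrier_mat k k" "D \<in> carrier_mat m m" "Q \<in> carrier_mat m m"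
  shows "congr (four_block_mat (1\<^sub>m k) (0\<^sub>m k m) (0\<^sub>m m k) Q)
      (four_block_mat C (0\<^sub>m k m) (0\<^sub>m m k) D)
    = four_block_mat C (0\<^sub>m k m) (0\<^sub>m m k) (congr Q D)"
proof -
  have T: "transpose_mat (four_block_mat (1\<^sub>m k) (0\<^sub>m k m) (0\<^sub>m m k) Q)
      = four_block_mat (1\<^sub>m k) (0\<^sub>m k m) (0\<^sub>m m k) (transpose_mat Q)"
    using assms by (subst transpose_four_block_mat[of _ k k _ m _ m]) auto
  show ?thesis unfolding congr_def T using assms
    by (simp add: mult_four_block_mat[of _ k k _ m _ m _ _ k _ m])
qed

lemma det_block_diag:
  fixes Q :: "real mat"
  assumes "Q \<in> carrier_mat m m"
  shows "det (four_block_mat (1\<^sub>m k) (0\<^sub>m k m) (0\<^sub>m m k) Q) = det Q"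
  using assms by (subst det_four_block_mat_lower_left_zero[of _ k _ m]) auto

text \<open>The shear depends on \<open>X\<close> alone, so one \<open>X\<close> solving both
  systems clears the off-diagonal blocks of both matrices simultaneously.\<close>

lemma split_pencil:
  assumes MN: "M \<in> Sym n" "N \<in> Sym n" and n: "n = k + m" and X: "X \<in> carrier_mat k m"
    and MX: "\<And>i j. i < k \<Longrightarrow> j < m \<Longrightarrow> (\<Sum>l<k. M $$ (i, l) * X $$ (l, j)) = M $$ (i, k + j)"
    and NX: "\<And>i j. i < k \<Longrightarrow> j < m \<Longrightarrow> (\<Sum>l<k. N $$ (i, l) * X $$ (l, j)) = N $$ (i, k + j)"
  obtains Q M' N' where "Q \<in> carrier_mat n n" "det Q \<noteq> 0" "M' \<in> Sym m" "N' \<in> Sym m"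
    "congr Q M = four_block_mat (mat k k (\<lambda>ij. M $$ ij)) (0\<^sub>m k m) (0\<^sub>m m k) M'"
    "congr Q N = four_block_mat (mat k k (\<lambda>ij. N $$ ij)) (0\<^sub>m k m) (0\<^sub>m m k) N'"
proof -
  define Q :: "real mat" where "Q = four_block_mat (1\<^sub>m k) (- X) (0\<^sub>m m k) (1\<^sub>m m)"
  have "Q \<in> carrier_mat n n" using X n by (auto simp: Q_def)
  moreover have "det Q \<noteq> 0"
    unfolding Q_def using X by (subst det_four_block_mat_lower_left_zero[of _ k _ m]) auto
  ultimately show ?thesis
    using congr_shear[OF MN(1) n X MX] congr_shear[OF MN(2) n X NX] that[of Q]
    unfolding Q_def by metis
qed

text \<open>The hyperplane orthogonal to \<open>y\<close> is orthogonal to \<open>v\<close> for both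
  forms, and \<open>v \<bullet> y \<noteq> 0\<close> makes it a complement of the line through
  \<open>v\<close>.\<close>

lemma split_pencil_line:
  assumes SB: "S \<in> Sym n" "B \<in> Sym n" and n: "n = Suc m"
    and v: "v \<in> carrier_vec n" and y: "y \<in> carrier_vec n" and vy: "v \<bullet> y \<noteq> 0"
    and Sv: "S *\<^sub>v v = \<alpha> \<cdot>\<^sub>v y" and Bv: "B *\<^sub>v v = \<beta> \<cdot>\<^sub>v y"
  obtains Q C D S' B' where "Q \<in> carrier_mat n n" "det Q \<noteq> 0" "S' \<in> Sym m" "B' \<in> Sym m"
    "C \<in> carrier_mat 1 1" "D \<in> carrier_mat 1 1"
    "congr Q S = four_block_mat C (0\<^sub>m 1 m) (0\<^sub>m m 1) S'"
    "congr Q B = four_block_mat D (0\<^sub>m 1 m) (0\<^sub>m m 1) B'"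
proof -
  have "v \<noteq> 0\<^sub>v n" using vy y by auto
  then obtain P where P: "P \<in> carrier_mat n n" "det P \<noteq> 0" "P *\<^sub>v unit_vec n 0 = v"
    using obtain_mat_first_column[OF v] by metis
  \<comment> \<open>The functional given by \<open>y\<close> in the new coordinates; its coefficient
    at index 0 is \<open>v \<bullet> y\<close>.\<close>
  define z where "z = transpose_mat P *\<^sub>v y"
  have z: "z \<in> carrier_vec n" using P y by (auto simp: z_def)
  have z0: "z $ 0 \<noteq> 0"
  proof -
    have "z $ 0 = z \<bullet> unit_vec n 0" using z n by (simp add: scalar_prod_right_unit)
    also have "\<dots> = y \<bullet> v" unfolding z_def using P y by (simp add: transpose_vec_mult_scalar[of _ n n])
    finally show ?thesis using vy comm_scalar_prod[OF v y] by simp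
  qed
  have row0: "congr P A $$ (0, j) = c * z $ j"
    if A: "A \<in> Sym n" and c: "A *\<^sub>v v = c \<cdot>\<^sub>v y" and j: "j < n" for A c j
  proof -
    have "congr P A *\<^sub>v unit_vec n 0 = c \<cdot>\<^sub>v z"
      using P y SymD[OF A] c by (simp add: congr_mult_vec[of _ n] z_def mult_mat_vec[of _ n n])
    moreover have "(congr P A *\<^sub>v unit_vec n 0) $ j = congr P A $$ (j, 0)"
      using j n P SymD[OF A] by (simp add: scalar_prod_right_unit)
    ultimately have "congr P A $$ (j, 0) = c * z $ j" using z j by simp
    then show ?thesis using Sym_index[OF congr_Sym[OF P(1) A]] j n by simp
  qed
  \<comment> \<open>The rows of index 0 of the two matrices are \<open>\<alpha>\<close> and
    \<open>\<beta>\<close> times \<open>z\<close>, so this quotient solves both systems, even if a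
    factor is zero.\<close>
  define X where "X = mat 1 m (\<lambda>(i, j). z $ Suc j / z $ 0)"
  have X: "X \<in> carrier_mat 1 m" by (simp add: X_def)
  have n1: "n = 1 + m" using n by simp
  have "\<And>i j. i < 1 \<Longrightarrow> j < m \<Longrightarrow> (\<Sum>l<1. congr P S $$ (i, l) * X $$ (l, j)) = congr P S $$ (i, 1 + j)"
    "\<And>i j. i < 1 \<Longrightarrow> j < m \<Longrightarrow> (\<Sum>l<1. congr P B $$ (i, l) * X $$ (l, j)) = congr P B $$ (i, 1 + j)"
    using z0 n by (simp_all add: X_def row0[OF SB(1) Sv] row0[OF SB(2) Bv])
  from split_pencil[OF congr_Sym[OF P(1) SB(1)] congr_Sym[OF P(1) SB(2)] n1 X this]
  obtain Q S' B' where Q: "Q \<in> carrier_mat n n" "det Q \<noteq> 0" "S' \<in> Sym m" "B' \<in> Sym m"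
    "congr Q (congr P S) = four_block_mat (mat 1 1 (\<lambda>ij. congr P S $$ ij)) (0\<^sub>m 1 m) (0\<^sub>m m 1) S'"
    "congr Q (congr P B) = four_block_mat (mat 1 1 (\<lambda>ij. congr P B $$ ij)) (0\<^sub>m 1 m) (0\<^sub>m m 1) B'"
    by metis
  show ?thesis
    by (rule that[of "P * Q", OF _ _ Q(3,4)])
      (use P Q SB in \<open>auto simp: det_mult[of _ n] congr_mult[of _ n, symmetric] SymD\<close>)
qed

section \<open>Semi-definite blocks and diagonalization\<close>

lemma pos_semidef_lower_block:
  assumes S: "pos_semidef (k + m) (four_block_mat C (0\<^sub>m k m) (0\<^sub>m m k) D)"
    and C: "C \<in> carrier_mat k k" and D: "D \<in> Sym m"
  shows "pos_semidef m D"
proof -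
  note Dc = SymD(1)[OF D]
  have "v \<bullet> (D *\<^sub>v v) \<ge> 0" if v: "v \<in> carrier_vec m" for v
  proof -
    have "0\<^sub>v k @\<^sub>v v \<in> carrier_vec (k + m)" using v by auto
    with S have "0 \<le> (0\<^sub>v k @\<^sub>v v) \<bullet> (four_block_mat C (0\<^sub>m k m) (0\<^sub>m m k) D *\<^sub>v (0\<^sub>v k @\<^sub>v v))"
      unfolding pos_semidef_def by blast
    also have "four_block_mat C (0\<^sub>m k m) (0\<^sub>m m k) D *\<^sub>v (0\<^sub>v k @\<^sub>v v) = 0\<^sub>v k @\<^sub>v (D *\<^sub>v v)"
      using four_block_mat_mult_vec[OF C zero_carrier_mat zero_carrier_mat Dc zero_carrier_vec v] C Dc v
      by auto
    also have "(0\<^sub>v k @\<^sub>v v) \<bullet> (0\<^sub>v k @\<^sub>v (D *\<^sub>v v)) = v \<bullet> (D *\<^sub>v v)"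
      using v Dc by (subst scalar_prod_append[of _ k _ m]) auto
    finally show ?thesis .
  qed
  then show ?thesis using D unfolding pos_semidef_def by auto
qed

text \<open>If \<open>S\<close> is nonzero, some unit vector \<open>v\<close> lies outside its
  kernel, so \<open>v \<bullet> (S *\<^sub>v v) \<noteq> 0\<close> by
  \<open>pos_semidef_kernel\<close>. Its line splits off and the remaining block is again
  semi-definite.\<close>

lemma pos_semidef_diagonalization:
  assumes "pos_semidef n S"
  obtains Q where "Q \<in> carrier_mat n n" "det Q \<noteq> 0" "diagonal_mat (congr Q S)"
proof -
  have "\<exists>Q \<in> carrier_mat n n. det Q \<noteq> 0 \<and> diagonal_mat (congr Q S)"
    using assms
  proof (induction n arbitrary: S)
    case 0
    then show ?case by (intro bexI[of _ "1\<^sub>m 0"]) (auto simp: diagonal_mat_def pos_semidef_def Sym_def)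
  next
    case (Suc m)
    have S: "S \<in> Sym (Suc m)" and Sc: "S \<in> carrier_mat (Suc m) (Suc m)"
      using Suc.prems SymD by (auto simp: pos_semidef_def)
    show ?case
    proof (cases "S = 0\<^sub>m (Suc m) (Suc m)")
      case True
      then show ?thesis by (intro bexI[of _ "1\<^sub>m (Suc m)"]) (auto simp: diagonal_mat_def)
    next
      case False
      obtain i where i: "i < Suc m" "S *\<^sub>v unit_vec (Suc m) i \<noteq> 0\<^sub>v (Suc m)"
      proof -
        obtain i j where ij: "i < Suc m" "j < Suc m" "S $$ (i, j) \<noteq> 0"
          using False Sc by (metis carrier_matD eq_matI index_zero_mat)
        then have "(S *\<^sub>v unit_vec (Suc m) j) $ i \<noteq> 0" using Sc by (simp add: scalar_prod_right_unit)
        then have "S *\<^sub>v unit_vec (Suc m) j \<noteq> 0\<^sub>v (Suc m)" using ij by (metis index_zero_vec(1))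
        then show ?thesis using that[of j] ij by blast
      qed
      define v where "v = (unit_vec (Suc m) i :: real vec)"
      have v: "v \<in> carrier_vec (Suc m)" by (simp add: v_def)
      have "v \<bullet> (S *\<^sub>v v) \<noteq> 0" using pos_semidef_kernel[OF Suc.prems v] i by (auto simp: v_def)
      moreover have "S *\<^sub>v v = 1 \<cdot>\<^sub>v (S *\<^sub>v v)" by simp
      \<comment> \<open>The line is split off the pencil \<open>(S, S)\<close>, with
        \<open>y = S *\<^sub>v v\<close> and factor 1.\<close>
      ultimately obtain Q C D S' where Q: "Q \<in> carrier_mat (Suc m) (Suc m)" "det Q \<noteq> 0"
        "S' \<in> Sym m" "C \<in> carrier_mat 1 1"
        "congr Q S = four_block_mat C (0\<^sub>m 1 m) (0\<^sub>m m 1) S'"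
        using split_pencil_line[OF S S refl v mult_mat_vec_carrier[OF Sc v]] by metis
      have "pos_semidef (1 + m) (congr Q S)" using congr_pos_semidef[OF Q(1) Suc.prems] by simp
      then have "pos_semidef m S'" using Q by (intro pos_semidef_lower_block[of 1 m C]) auto
      from Suc.IH[OF this] obtain R where R: "R \<in> carrier_mat m m" "det R \<noteq> 0" "diagonal_mat (congr R S')"
        by blast
      define T where "T = four_block_mat (1\<^sub>m 1) (0\<^sub>m 1 m) (0\<^sub>m m 1) R"
      have T: "T \<in> carrier_mat (Suc m) (Suc m)" "det T \<noteq> 0"
        using R det_block_diag[OF R(1), of 1] by (auto simp: T_def)
      have "congr (Q * T) S = four_block_mat C (0\<^sub>m 1 m) (0\<^sub>m m 1) (congr R S')"
        using congr_mult[OF Q(1) T(1) Sc] Q congr_block_diag[OF Q(4) _ R(1), of S'] SymD[OF Q(3)]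
        by (simp add: T_def)
      then have "diagonal_mat (congr (Q * T) S)"
        using R Q SymD[OF Q(3)] by (auto simp: diagonal_mat_def)
      then show ?thesis using Q T by (intro bexI[of _ "Q * T"]) (auto simp: det_mult[of _ "Suc m"])
    qed
  qed
  then show ?thesis using that by blast
qed

section \<open>Disjointness and semi-definite pencils\<close>

lemma pos_semidef_diag_nonneg:
  assumes "pos_semidef n A" "i < n"
  shows "A $$ (i, i) \<ge> 0"
  using assms unit_vec_quadratic[of A n i i] SymD(1)[of A n]
  unfolding pos_semidef_def by (metis unit_vec_carrier)

lemma prod_list_positive:
  fixes xs :: "'a :: linordered_semidom list"
  shows "(\<And>x. x \<in> set xs \<Longrightarrow> x > 0) \<Longrightarrow> prod_list xs > 0"
  by (induction xs) auto

text \<open>A diagonal matrix congruent to \<open>X\<close> has positive diagonal entries, and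
  congruence multiplies the determinant by the square of \<open>det Q\<close>.\<close>

lemma pos_def_det_pos:
  assumes "pos_def n X"
  shows "det X > 0"
proof -
  have X: "X \<in> carrier_mat n n" and pos: "\<And>v. v \<in> carrier_vec n \<Longrightarrow> v \<noteq> 0\<^sub>v n \<Longrightarrow> v \<bullet> (X *\<^sub>v v) > 0"
    using assms SymD by (auto simp: pos_def_def)
  obtain Q where Q: "Q \<in> carrier_mat n n" "det Q \<noteq> 0" "diagonal_mat (congr Q X)"
    using pos_semidef_diagonalization[OF pos_def_imp_semidef[OF assms]] by metis
  define D where "D = congr Q X"
  have D: "D \<in> carrier_mat n n" using Q X by (simp add: D_def)
  have "D $$ (i, i) > 0" if "i < n" for i
  proof -
    have "unit_vec n i \<noteq> (0\<^sub>v n :: real vec)" using that by (simp add: unit_vec_nonzero)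
    then have "Q *\<^sub>v unit_vec n i \<noteq> 0\<^sub>v n" using mult_mat_vec_nonzero[OF Q(1,2)] by simp
    then show ?thesis
      using pos[of "Q *\<^sub>v unit_vec n i"] Q X that unit_vec_quadratic[OF D that that]
      by (simp add: D_def scalar_congr_mult_vec[of _ n] mult_mat_vec_carrier[of _ n n])
  qed
  moreover have "det D = prod_list (diag_mat D)"
    by (rule det_upper_triangular[OF _ D])
      (use D Q(3) in \<open>auto simp: diagonal_mat_def D_def\<close>)
  ultimately have "det D > 0"
    using D by (auto simp: diag_mat_def intro!: prod_list_positive)
  moreover have "det D = (det Q)\<^sup>2 * det X"
    unfolding D_def congr_def using Q X
    by (simp add: det_mult[of _ n] det_transpose[of _ n] power2_eq_square)
  ultimately show ?thesis by (simp add: zero_less_mult_iff)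
qed

lemma trace_mat_comm:
  assumes "A \<in> carrier_mat n m" "B \<in> carrier_mat m n"
  shows "trace_mat (A * B) = trace_mat (B * A)"
  using assms unfolding trace_mat_def
  by (simp add: scalar_prod_def atLeast0LessThan) (subst sum.swap, simp add: mult.commute)

lemma trace_mat_mult:
  assumes "A \<in> carrier_mat n n" "B \<in> carrier_mat n n"
  shows "trace_mat (A * B) = (\<Sum>i<n. \<Sum>j<n. A $$ (i, j) * B $$ (j, i))"
  using assms unfolding trace_mat_def by (simp add: scalar_prod_def atLeast0LessThan)

lemma trace_mat_mult_lincomb:
  assumes "X \<in> carrier_mat n n" "A \<in> carrier_mat n n" "B \<in> carrier_mat n n"
  shows "trace_mat (X * (a \<cdot>\<^sub>m A + b \<cdot>\<^sub>m B)) = a * trace_mat (X * A) + b * trace_mat (X * B)"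
  using assms
  by (simp add: trace_mat_mult[of _ n] algebra_simps sum.distrib sum_distrib_left)

lemma trace_mat_lincomb_mult:
  assumes "X \<in> carrier_mat n n" "Y \<in> carrier_mat n n" "A \<in> carrier_mat n n"
  shows "trace_mat ((a \<cdot>\<^sub>m X + b \<cdot>\<^sub>m Y) * A) = a * trace_mat (X * A) + b * trace_mat (Y * A)"
  using assms
  by (simp add: trace_mat_mult[of _ n] algebra_simps sum.distrib sum_distrib_left)

text \<open>Diagonalising gives \<open>S = congr R D\<close> with \<open>D\<close> diagonal and
  nonnegative. The trace becomes the sum of \<open>D $$ (k, k)\<close> times the form of
  \<open>X\<close> at row \<open>k\<close> of \<open>R\<close>; each form value is positive, and
  some diagonal entry of \<open>D\<close> is too.\<close>

lemma trace_pos_def_pos_semidef: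
  assumes X: "pos_def n X" and S: "pos_semidef n S" and S0: "S \<noteq> 0\<^sub>m n n"
  shows "trace_mat (X * S) > 0"
proof -
  have Xc: "X \<in> carrier_mat n n" and pos: "\<And>v. v \<in> carrier_vec n \<Longrightarrow> v \<noteq> 0\<^sub>v n \<Longrightarrow> v \<bullet> (X *\<^sub>v v) > 0"
    using X SymD by (auto simp: pos_def_def)
  have Sc: "S \<in> carrier_mat n n" using S SymD by (auto simp: pos_semidef_def)
  obtain Q where Q: "Q \<in> carrier_mat n n" "det Q \<noteq> 0" "diagonal_mat (congr Q S)"
    using pos_semidef_diagonalization[OF S] by metis
  obtain R where R: "R \<in> carrier_mat n n" "Q * R = 1\<^sub>m n" "det R \<noteq> 0"
    using obtain_inverse_mat[OF Q(1,2)] by metis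
  define D where "D = congr Q S"
  have D: "D \<in> carrier_mat n n" using Q Sc by (simp add: D_def)
  have D0: "D $$ (k, k) \<ge> 0" if "k < n" for k
    unfolding D_def using pos_semidef_diag_nonneg[OF congr_pos_semidef[OF Q(1) S] that] .
  define r where "r k = transpose_mat R *\<^sub>v unit_vec n k" for k
  have r: "r k \<in> carrier_vec n" for k using R by (auto simp: r_def)
  have rpos: "r k \<bullet> (X *\<^sub>v r k) > 0" if "k < n" for k
  proof (rule pos[OF r])
    show "r k \<noteq> 0\<^sub>v n" unfolding r_def
      by (rule mult_mat_vec_nonzero) (use R that in \<open>auto simp: det_transpose unit_vec_nonzero\<close>)
  qed
  have "congr R D = S" using R Q Sc unfolding D_def by (simp add: congr_mult[of _ n])
  then have "trace_mat (X * S) = trace_mat (X * (transpose_mat R * D * R))" by (simp add: congr_def)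
  also have "X * (transpose_mat R * D * R) = (X * transpose_mat R) * (D * R)"
    using Xc R D by (simp add: assoc_mult_mat[of _ n n _ n _ n])
  also have "trace_mat \<dots> = trace_mat ((D * R) * (X * transpose_mat R))"
    using Xc R D by (intro trace_mat_comm[of _ n n]) auto
  also have "(D * R) * (X * transpose_mat R) = D * congr (transpose_mat R) X"
    unfolding congr_def using Xc R D by (simp add: assoc_mult_mat[of _ n n _ n _ n])
  also have "trace_mat \<dots> = (\<Sum>k<n. D $$ (k, k) * congr (transpose_mat R) X $$ (k, k))"
  proof -
    have "(\<Sum>j<n. D $$ (k, j) * congr (transpose_mat R) X $$ (j, k))
        = D $$ (k, k) * congr (transpose_mat R) X $$ (k, k)" if "k < n" for k
      by (subst sum.remove[of _ k]) (use that Q(3) D in \<open>auto simp: diagonal_mat_def D_def intro!: sum.neutral\<close>)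
    then show ?thesis using D R Xc by (simp add: trace_mat_mult[of _ n])
  qed
  also have "\<dots> = (\<Sum>k<n. D $$ (k, k) * (r k \<bullet> (X *\<^sub>v r k)))"
  proof (rule sum.cong)
    fix k assume "k \<in> {..<n}"
    then have k: "k < n" by simp
    have "congr (transpose_mat R) X $$ (k, k) = r k \<bullet> (X *\<^sub>v r k)"
      using unit_vec_quadratic[of "congr (transpose_mat R) X" n k k] k R Xc
      by (simp add: scalar_congr_mult_vec[of _ n] r_def)
    then show "D $$ (k, k) * congr (transpose_mat R) X $$ (k, k) = D $$ (k, k) * (r k \<bullet> (X *\<^sub>v r k))"
      by simp
  qed simp
  also have "\<dots> > 0"
  proof -
    have "D \<noteq> 0\<^sub>m n n" using congr_eq_zeroD[OF Q(1,2) Sc] S0 by (auto simp: D_def)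
    then obtain i j where ij: "i < n" "j < n" "D $$ (i, j) \<noteq> 0"
      using D by (metis carrier_matD eq_matI index_zero_mat)
    then have "i = j" using Q(3) D unfolding diagonal_mat_def D_def by auto
    with ij D0[of i] have "D $$ (i, i) > 0" by simp
    then show ?thesis using D0 rpos ij(1)
      by (intro sum_pos2[of _ i]) (auto simp: less_imp_le)
  qed
  finally show ?thesis .
qed

text \<open>At a common point both traces vanish, hence also the trace against the semi-definite
  combination, which has to be positive.\<close>

lemma perp_disjoint_if_semidef_pencil:
  assumes AB: "A \<in> carrier_mat n n" "B \<in> carrier_mat n n" and "semidef_pencil n A B"
  shows "perp n A \<inter> perp n B = {}"
proof -
  obtain c1 c2 where c: "c1 \<cdot>\<^sub>m A + c2 \<cdot>\<^sub>m B \<noteq> 0\<^sub>m n n" "pos_semidef n (c1 \<cdot>\<^sub>m A + c2 \<cdot>\<^sub>m B)"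
    using assms unfolding semidef_pencil_def by auto
  have False if X: "X \<in> perp n A" "X \<in> perp n B" for X
  proof -
    have "pos_def n X" "X \<in> carrier_mat n n" using X SymD by (auto simp: perp_def P_space_def)
    from trace_pos_def_pos_semidef[OF this(1) c(2,1)] trace_mat_mult_lincomb[OF this(2) AB, of c1 c2]
    show False using X by (simp add: perp_def)
  qed
  then show ?thesis by blast
qed

section \<open>The cone of positive definite matrices\<close>

lemma smult_mat_mult_vec:
  fixes A :: "'a :: comm_ring_1 mat"
  assumes "A \<in> carrier_mat m n" "v \<in> carrier_vec n"
  shows "(a \<cdot>\<^sub>m A) *\<^sub>v v = a \<cdot>\<^sub>v (A *\<^sub>v v)"
  using assms by (intro eq_vecI) (auto simp: scalar_prod_def sum_distrib_left mult_ac)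

text \<open>The asymmetric hypotheses serve three uses: convex combinations, perturbing a
  semi-definite matrix by a small multiple of the identity, and, with \<open>b = 0\<close>,
  scaling.\<close>

lemma pos_def_lincomb:
  assumes X: "pos_def n X" and Y: "pos_semidef n Y" and ab: "a > 0" "b \<ge> 0"
  shows "pos_def n (a \<cdot>\<^sub>m X + b \<cdot>\<^sub>m Y)"
proof -
  have c: "X \<in> Sym n" "Y \<in> Sym n" "X \<in> carrier_mat n n" "Y \<in> carrier_mat n n"
    using X Y SymD by (auto simp: pos_def_def pos_semidef_def)
  have "v \<bullet> ((a \<cdot>\<^sub>m X + b \<cdot>\<^sub>m Y) *\<^sub>v v) > 0" if v: "v \<in> carrier_vec n" "v \<noteq> 0\<^sub>v n" for v
  proof -
    have "(a \<cdot>\<^sub>m X + b \<cdot>\<^sub>m Y) *\<^sub>v v = a \<cdot>\<^sub>v (X *\<^sub>v v) + b \<cdot>\<^sub>v (Y *\<^sub>v v)"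
      using c v by (simp add: add_mult_distrib_mat_vec[of _ n n] smult_mat_mult_vec[of _ n n])
    then have "v \<bullet> ((a \<cdot>\<^sub>m X + b \<cdot>\<^sub>m Y) *\<^sub>v v) = a * (v \<bullet> (X *\<^sub>v v)) + b * (v \<bullet> (Y *\<^sub>v v))"
      using c v by (simp add: scalar_prod_add_distrib[of _ n])
    also have "\<dots> > 0"
      using X Y v ab by (intro add_pos_nonneg) (auto simp: pos_def_def pos_semidef_def)
    finally show ?thesis .
  qed
  moreover have "a \<cdot>\<^sub>m X + b \<cdot>\<^sub>m Y \<in> Sym n"
    using c Sym_index[of X n] Sym_index[of Y n] by (intro SymI) auto
  ultimately show ?thesis by (auto simp: pos_def_def)
qed

lemma pos_def_one: "pos_def n (1\<^sub>m n)"
  unfolding pos_def_def Sym_def by (auto intro: scalar_prod_self_pos)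

text \<open>The form of the outer product of \<open>v\<close> with itself at \<open>w\<close> is
  \<open>(v \<bullet> w)\<^sup>2\<close>.\<close>

lemma pos_semidef_outer:
  fixes v :: "real vec"
  assumes v: "v \<in> carrier_vec n"
  shows "pos_semidef n (mat n n (\<lambda>(i, j). v $ i * v $ j))" (is "pos_semidef n ?V")
proof -
  have "w \<bullet> (?V *\<^sub>v w) = (v \<bullet> w)\<^sup>2" if w: "w \<in> carrier_vec n" for w
    using v w
    by (simp add: scalar_prod_def power2_eq_square sum_product sum_distrib_left sum_distrib_right mult_ac)
  then show ?thesis unfolding pos_semidef_def by (auto intro!: SymI)
qed

text \<open>The value \<open>v \<bullet> (S *\<^sub>v v)\<close> is the trace of
  \<open>V * S\<close> for the outer product \<open>V\<close> of \<open>v\<close> with itself. As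
  \<open>V\<close> is only semi-definite, it is approached by the definite matrices
  \<open>e \<cdot>\<^sub>m 1\<^sub>m n + V\<close> as \<open>e\<close> tends to 0 from
  above.\<close>

lemma pos_semidef_if_trace_nonneg:
  assumes S: "S \<in> Sym n" and nn: "\<And>X. pos_def n X \<Longrightarrow> trace_mat (X * S) \<ge> 0"
  shows "pos_semidef n S"
proof -
  note Sc = SymD(1)[OF S]
  have "v \<bullet> (S *\<^sub>v v) \<ge> 0" if v: "v \<in> carrier_vec n" for v
  proof -
    define V where "V = mat n n (\<lambda>(i, j). v $ i * v $ j)"
    have V: "pos_semidef n V" "V \<in> carrier_mat n n"
      using pos_semidef_outer[OF v] by (auto simp: V_def)
    have "trace_mat (V * S) = (\<Sum>i<n. \<Sum>j<n. v $ i * v $ j * S $$ (i, j))"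
      using Sc V Sym_index[OF S] by (simp add: trace_mat_mult[of _ n] V_def)
    also have "\<dots> = v \<bullet> (S *\<^sub>v v)"
      using v Sc by (simp add: scalar_prod_def atLeast0LessThan sum_distrib_left mult_ac)
    finally have tr: "trace_mat (V * S) = v \<bullet> (S *\<^sub>v v)" .
    have "0 \<le> e * trace_mat (1\<^sub>m n * S) + v \<bullet> (S *\<^sub>v v)" if "e > 0" for e
      using nn[OF pos_def_lincomb[OF pos_def_one V(1) that zero_le_one]]
        trace_mat_lincomb_mult[OF one_carrier_mat V(2) Sc, of e 1] tr by simp
    then have "eventually (\<lambda>e. 0 \<le> e * trace_mat (1\<^sub>m n * S) + v \<bullet> (S *\<^sub>v v)) (at_right 0)"
      by (rule eventually_mono[OF eventually_at_right_less])
    moreover have "((\<lambda>e. e * trace_mat (1\<^sub>m n * S) + v \<bullet> (S *\<^sub>v v))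
        \<longlongrightarrow> 0 * trace_mat (1\<^sub>m n * S) + v \<bullet> (S *\<^sub>v v)) (at_right 0)"
      by (intro tendsto_intros)
    ultimately have "0 \<le> 0 * trace_mat (1\<^sub>m n * S) + v \<bullet> (S *\<^sub>v v)"
      by (metis tendsto_lowerbound trivial_limit_at_right_real)
    then show ?thesis by simp
  qed
  then show ?thesis using S by (auto simp: pos_semidef_def)
qed

text \<open>Scaling by \<open>c\<close> multiplies the determinant by \<open>c ^ n\<close>, so an
  \<open>n\<close>-th root normalises it.\<close>

lemma pos_def_scale_P_space:
  assumes X: "pos_def n X" and n: "n > 0"
  obtains c where "c > 0" "c \<cdot>\<^sub>m X \<in> P_space n"
proof -
  have Xc: "X \<in> carrier_mat n n" using X SymD by (auto simp: pos_def_def)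
  define c where "c = root n (1 / det X)"
  have c: "c > 0" using pos_def_det_pos[OF X] n by (simp add: c_def)
  have "c ^ n * det X = 1"
    using pos_def_det_pos[OF X] n by (simp add: c_def)
  \<comment> \<open>A scalar multiple in the shape required by
    \<open>pos_def_lincomb\<close>.\<close>
  moreover have "c \<cdot>\<^sub>m X + 0 \<cdot>\<^sub>m X = c \<cdot>\<^sub>m X" using Xc by (intro eq_matI) auto
  ultimately have "c \<cdot>\<^sub>m X \<in> P_space n"
    using pos_def_lincomb[OF X pos_def_imp_semidef[OF X] c order_refl] Xc
    by (auto simp: P_space_def pos_def_def)
  with c show ?thesis using that by blast
qed

text \<open>The coefficients are those of a functional separating the origin from the set
  \<open>T\<close> of trace pairs; \<open>pos_semidef_if_trace_nonneg\<close> turns separation into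
  semi-definiteness.\<close>

lemma semidef_pencil_if_perp_disjoint:
  assumes A: "is_hyperplane n A" and B: "is_hyperplane n B" and disj: "perp n A \<inter> perp n B = {}"
  shows "semidef_pencil n A B"
proof -
  have S: "A \<in> Sym n" "B \<in> Sym n" and c: "A \<in> carrier_mat n n" "B \<in> carrier_mat n n"
    and A0: "A \<noteq> 0\<^sub>m n n" and B0: "B \<noteq> 0\<^sub>m n n"
    using A B SymD by (auto simp: is_hyperplane_def)
  have "n > 0" using A0 c by (metis carrier_matD eq_matI gr0I index_zero_mat(2,3) not_less_zero)
  have tr_smult: "trace_mat ((t \<cdot>\<^sub>m X) * Y) = t * trace_mat (X * Y)"
    "trace_mat (X * (t \<cdot>\<^sub>m Y)) = t * trace_mat (X * Y)"
    if "X \<in> carrier_mat n n" "Y \<in> carrier_mat n n" for t and X Y :: "real mat"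
    using that by (simp_all add: trace_mat_mult[of _ n] sum_distrib_left mult_ac)
  define T where "T = (\<lambda>X. (trace_mat (X * A), trace_mat (X * B))) ` {X. pos_def n X}"
  have carr: "X \<in> carrier_mat n n" if "pos_def n X" for X using that SymD by (auto simp: pos_def_def)
  have "convex T"
    unfolding convex_alt
  proof (intro ballI allI impI)
    fix x y and u :: real
    assume "x \<in> T" "y \<in> T" and u: "0 \<le> u \<and> u \<le> 1"
    then obtain X Y where X: "pos_def n X" "x = (trace_mat (X * A), trace_mat (X * B))"
      and Y: "pos_def n Y" "y = (trace_mat (Y * A), trace_mat (Y * B))"
      by (auto simp: T_def)
    define Z where "Z = (1 - u) \<cdot>\<^sub>m X + u \<cdot>\<^sub>m Y"
    \<comment> \<open>At \<open>u = 1\<close> the coefficient of \<open>X\<close> vanishes, and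
      \<open>pos_def_lincomb\<close> does not apply.\<close>
    have "pos_def n Z"
    proof (cases "u = 1")
      case True
      then have "Z = Y" using carr[OF X(1)] carr[OF Y(1)] by (intro eq_matI) (auto simp: Z_def)
      then show ?thesis using Y by simp
    next
      case False
      then show ?thesis unfolding Z_def using u X Y
        by (intro pos_def_lincomb pos_def_imp_semidef) auto
    qed
    moreover have "(1 - u) *\<^sub>R x + u *\<^sub>R y = (trace_mat (Z * A), trace_mat (Z * B))"
      using carr[OF X(1)] carr[OF Y(1)] c by (simp add: X Y Z_def trace_mat_lincomb_mult[of _ n])
    ultimately show "(1 - u) *\<^sub>R x + u *\<^sub>R y \<in> T" by (auto simp: T_def)
  qed
  moreover have "0 \<notin> T"
  proof
    assume "0 \<in> T"
    then obtain X where X: "pos_def n X" "trace_mat (X * A) = 0" "trace_mat (X * B) = 0"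
      by (auto simp: T_def zero_prod_def)
    obtain t where "t \<cdot>\<^sub>m X \<in> P_space n" using pos_def_scale_P_space[OF X(1) \<open>n > 0\<close>] by metis
    then have "t \<cdot>\<^sub>m X \<in> perp n A \<inter> perp n B"
      using X carr[OF X(1)] c by (simp add: perp_def tr_smult)
    then show False using disj by blast
  qed
  ultimately obtain a where a: "a \<noteq> 0" "\<forall>x\<in>T. 0 \<le> inner a x"
    using separating_hyperplane_set_0 by blast
  define C where "C = fst a \<cdot>\<^sub>m A + snd a \<cdot>\<^sub>m B"
  have C: "C \<in> Sym n" unfolding C_def
    using c Sym_index[OF S(1)] Sym_index[OF S(2)] by (intro SymI) auto
  have "trace_mat (X * C) \<ge> 0" if "pos_def n X" for X
    using a(2) that carr[OF that] c
    by (auto simp: T_def C_def trace_mat_mult_lincomb[of _ n] inner_prod_def)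
  from pos_semidef_if_trace_nonneg[OF C this] have "pos_semidef n C" .
  \<comment> \<open>Otherwise \<open>B\<close> would be a multiple of \<open>A\<close>, and the
    non-empty set \<open>perp n A\<close> would lie inside \<open>perp n B\<close>.\<close>
  moreover have "C \<noteq> 0\<^sub>m n n"
  proof
    assume C0: "C = 0\<^sub>m n n"
    have e: "fst a * A $$ (i, j) + snd a * B $$ (i, j) = 0" if "i < n" "j < n" for i j
      using arg_cong[OF C0, of "\<lambda>M. M $$ (i, j)"] that c by (simp add: C_def)
    have "snd a \<noteq> 0"
    proof
      assume "snd a = 0"
      with a(1) have "fst a \<noteq> 0" by (metis prod_eqI fst_zero snd_zero)
      then have "A = 0\<^sub>m n n" using e \<open>snd a = 0\<close> c by (intro eq_matI) auto
      with A0 show False ..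
    qed
    then have "B = (- fst a / snd a) \<cdot>\<^sub>m A"
      using e c by (intro eq_matI) (auto simp: field_simps, metis add.commute add_eq_0_iff minus_mult_left mult.commute)
    then have "perp n A \<subseteq> perp n B"
      using c SymD(1) by (auto simp: perp_def P_space_def tr_smult)
    then show False using disj A by (auto simp: is_hyperplane_def)
  qed
  ultimately show ?thesis unfolding semidef_pencil_def C_def by blast
qed

section \<open>Reduction of semi-definite pencils\<close>

text \<open>The range of a symmetric matrix is the orthogonal complement of its kernel. In
  diagonalising coordinates the equation is solved entry by entry.\<close>

lemma pos_semidef_range:
  assumes S: "pos_semidef n S" and c: "c \<in> carrier_vec n"
    and orth: "\<And>w. w \<in> carrier_vec n \<Longrightarrow> S *\<^sub>v w = 0\<^sub>v n \<Longrightarrow> w \<bullet> c = 0"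
  obtains u where "u \<in> carrier_vec n" "S *\<^sub>v u = c"
proof -
  have Sc: "S \<in> carrier_mat n n" using S SymD by (auto simp: pos_semidef_def)
  obtain Q where Q: "Q \<in> carrier_mat n n" "det Q \<noteq> 0" "diagonal_mat (congr Q S)"
    using pos_semidef_diagonalization[OF S] by metis
  obtain R where R: "R \<in> carrier_mat n n" "Q * R = 1\<^sub>m n"
    using obtain_inverse_mat[OF Q(1,2)] by metis
  define D where "D = congr Q S"
  have D: "D \<in> carrier_mat n n" using Q Sc by (simp add: D_def)
  define e where "e = transpose_mat Q *\<^sub>v c"
  have e: "e \<in> carrier_vec n" using Q c by (auto simp: e_def)
  \<comment> \<open>A column of \<open>Q\<close> with zero diagonal entry lies in the kernel of
    \<open>S\<close> by \<open>pos_semidef_kernel\<close>, so it is orthogonal to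
    \<open>c\<close>.\<close>
  have e0: "e $ i = 0" if i: "i < n" and Dii: "D $$ (i, i) = 0" for i
  proof -
    define q where "q = Q *\<^sub>v unit_vec n i"
    have q: "q \<in> carrier_vec n" using Q by (auto simp: q_def)
    have "q \<bullet> (S *\<^sub>v q) = 0"
      using unit_vec_quadratic[OF D i i] Dii Q Sc by (simp add: D_def q_def scalar_congr_mult_vec[of _ n])
    then have "q \<bullet> c = 0" using orth[OF q] pos_semidef_kernel[OF S q] by simp
    moreover have "e $ i = e \<bullet> unit_vec n i" using e i by (simp add: scalar_prod_right_unit)
    moreover have "e \<bullet> unit_vec n i = c \<bullet> q"
      unfolding e_def q_def by (rule transpose_vec_mult_scalar) (use Q c in auto)
    ultimately show ?thesis using comm_scalar_prod[OF c q] by simp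
  qed
  \<comment> \<open>Relies on \<open>0 / 0 = 0\<close>: \<open>e\<close> vanishes wherever \<open>D\<close> does.\<close>
  define y where "y = vec n (\<lambda>i. e $ i / D $$ (i, i))"
  have y: "y \<in> carrier_vec n" by (simp add: y_def)
  have "D *\<^sub>v y = e"
  proof (rule eq_vecI)
    fix i assume "i < dim_vec e"
    then have i: "i < n" using e by simp
    have "(D *\<^sub>v y) $ i = (\<Sum>j<n. D $$ (i, j) * y $ j)"
      using D y i by (simp add: scalar_prod_def atLeast0LessThan)
    also have "\<dots> = D $$ (i, i) * y $ i"
      by (subst sum.remove[of _ i]) (use i Q(3) D in \<open>auto simp: diagonal_mat_def D_def intro!: sum.neutral\<close>)
    also have "\<dots> = e $ i" using e0[OF i] i by (auto simp: y_def)
    finally show "(D *\<^sub>v y) $ i = e $ i" .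
  qed (use D e in auto)
  then have "transpose_mat Q *\<^sub>v (S *\<^sub>v (Q *\<^sub>v y)) = transpose_mat Q *\<^sub>v c"
    using congr_mult_vec[OF Q(1) Sc y] by (simp add: D_def e_def)
  then have eq: "transpose_mat R *\<^sub>v (transpose_mat Q *\<^sub>v (S *\<^sub>v (Q *\<^sub>v y)))
      = transpose_mat R *\<^sub>v (transpose_mat Q *\<^sub>v c)" by simp
  have "transpose_mat R * transpose_mat Q = 1\<^sub>m n"
    using R Q transpose_mult[of Q n n R n] by simp
  then have cancel: "transpose_mat R *\<^sub>v (transpose_mat Q *\<^sub>v x) = x" if "x \<in> carrier_vec n" for x
    using that R Q assoc_mult_mat_vec[of "transpose_mat R" n n "transpose_mat Q" n x] by simp
  have "Q *\<^sub>v y \<in> carrier_vec n" using Q y by auto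
  with eq cancel[OF c] cancel[of "S *\<^sub>v (Q *\<^sub>v y)"] Sc show ?thesis
    using that[of "Q *\<^sub>v y"] by auto
qed

section \<open>Real eigenvectors of definite pencils\<close>

lemma complex_mat_vec_Re_Im:
  fixes M :: "real mat"
  assumes M: "M \<in> carrier_mat n n" and z: "z \<in> carrier_vec n"
  shows "map_vec Re (map_mat complex_of_real M *\<^sub>v z) = M *\<^sub>v map_vec Re z"
    and "map_vec Im (map_mat complex_of_real M *\<^sub>v z) = M *\<^sub>v map_vec Im z"
  using assms by (intro eq_vecI; simp add: scalar_prod_def)+

text \<open>A complex eigenvector of the inverse of \<open>S\<close> times \<open>B\<close> has a
  real eigenvalue by symmetry of \<open>S\<close> and \<open>B\<close>, so its real and imaginary
  parts both satisfy the equation, and one of them is nonzero.\<close>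

lemma pos_def_pencil_eigenvector:
  assumes S: "pos_def n S" and B: "B \<in> Sym n" and n: "n > 0"
  obtains v \<mu> where "v \<in> carrier_vec n" "v \<noteq> 0\<^sub>v n" "B *\<^sub>v v = \<mu> \<cdot>\<^sub>v (S *\<^sub>v v)"
proof -
  have SS: "S \<in> Sym n" and pos: "\<And>v. v \<in> carrier_vec n \<Longrightarrow> v \<noteq> 0\<^sub>v n \<Longrightarrow> v \<bullet> (S *\<^sub>v v) > 0"
    using S by (auto simp: pos_def_def)
  note Sc = SymD(1)[OF SS] and Bc = SymD(1)[OF B]
  have "S *\<^sub>v v \<noteq> 0\<^sub>v n" if "v \<in> carrier_vec n" "v \<noteq> 0\<^sub>v n" for v
    using pos[OF that] that by (metis less_irrefl scalar_prod_right_zero)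
  then have "det S \<noteq> 0" using det_0_iff_vec_prod_zero[OF Sc] by blast
  then obtain R where R: "R \<in> carrier_mat n n" "S * R = 1\<^sub>m n"
    using obtain_inverse_mat[OF Sc] by metis
  define M where "M = R * B"
  have M: "M \<in> carrier_mat n n" using R Bc by (auto simp: M_def)
  have SM: "S *\<^sub>v (M *\<^sub>v w) = B *\<^sub>v w" if w: "w \<in> carrier_vec n" for w
  proof -
    have "S * M = B" unfolding M_def using R Sc Bc by (simp add: assoc_mult_mat[of _ n n _ n _ n, symmetric])
    then show ?thesis using assoc_mult_mat_vec[OF Sc M w] by simp
  qed
  \<comment> \<open>\<open>M\<close> need not be symmetric, so an eigenvector is first sought over
    the complex numbers.\<close>
  have "spectrum (map_mat complex_of_real M) \<noteq> {}"
    using M n by (intro spectrum_non_empty[of _ n]) auto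
  then obtain k z where z: "z \<in> carrier_vec n" "z \<noteq> 0\<^sub>v n"
    "map_mat complex_of_real M *\<^sub>v z = k \<cdot>\<^sub>v z"
    using M unfolding spectrum_def eigenvalue_def eigenvector_def by auto
  define x y a b where "x = map_vec Re z" and "y = map_vec Im z" and "a = Re k" and "b = Im k"
  have xy: "x \<in> carrier_vec n" "y \<in> carrier_vec n" using z by (auto simp: x_def y_def)
  have "M *\<^sub>v x = map_vec Re (k \<cdot>\<^sub>v z)" "M *\<^sub>v y = map_vec Im (k \<cdot>\<^sub>v z)"
    unfolding x_def y_def z(3)[symmetric] using complex_mat_vec_Re_Im[OF M z(1)] by simp_all
  then have Mx: "M *\<^sub>v x = a \<cdot>\<^sub>v x + (- b) \<cdot>\<^sub>v y" and My: "M *\<^sub>v y = b \<cdot>\<^sub>v x + a \<cdot>\<^sub>v y"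
    using z(1) by (auto simp: x_def y_def a_def b_def intro!: eq_vecI)
  have S_lin: "S *\<^sub>v (s \<cdot>\<^sub>v x + t \<cdot>\<^sub>v y) = s \<cdot>\<^sub>v (S *\<^sub>v x) + t \<cdot>\<^sub>v (S *\<^sub>v y)" for s t
    using xy Sc by (simp add: mult_add_distrib_mat_vec[of _ n n] mult_mat_vec[of _ n n])
  have Bx: "B *\<^sub>v x = a \<cdot>\<^sub>v (S *\<^sub>v x) + (- b) \<cdot>\<^sub>v (S *\<^sub>v y)"
    and By: "B *\<^sub>v y = b \<cdot>\<^sub>v (S *\<^sub>v x) + a \<cdot>\<^sub>v (S *\<^sub>v y)"
    using SM[OF xy(1)] SM[OF xy(2)] unfolding Mx My S_lin by simp_all
  have Sxy: "S *\<^sub>v x \<in> carrier_vec n" "S *\<^sub>v y \<in> carrier_vec n" using Sc xy by auto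
  have ne: "x \<noteq> 0\<^sub>v n \<or> y \<noteq> 0\<^sub>v n"
  proof (rule ccontr)
    assume "\<not> ?thesis"
    then have "x $ i = 0 \<and> y $ i = 0" if "i < n" for i using that by simp
    then have "z = 0\<^sub>v n" using z(1) by (intro eq_vecI) (auto simp: x_def y_def complex_eq_iff)
    with z(2) show False ..
  qed
  \<comment> \<open>Expanding both sides, the terms with \<open>a\<close> cancel by symmetry of
    \<open>S\<close>; what is left is \<open>b\<close> times a positive number.\<close>
  have "y \<bullet> (B *\<^sub>v x) = x \<bullet> (B *\<^sub>v y)" by (rule scalar_Sym_comm[OF B xy(2,1)])
  then have "a * (y \<bullet> (S *\<^sub>v x)) - b * (y \<bullet> (S *\<^sub>v y)) = b * (x \<bullet> (S *\<^sub>v x)) + a * (x \<bullet> (S *\<^sub>v y))"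
    unfolding Bx By using xy Sxy by (simp add: scalar_prod_add_distrib[of _ n])
  then have "b * (x \<bullet> (S *\<^sub>v x) + y \<bullet> (S *\<^sub>v y)) = 0"
    using scalar_Sym_comm[OF SS xy] by (simp add: algebra_simps)
  moreover have nn: "v \<bullet> (S *\<^sub>v v) \<ge> 0" if "v \<in> carrier_vec n" for v
    using pos_def_imp_semidef[OF S] that by (simp add: pos_semidef_def)
  have "x \<bullet> (S *\<^sub>v x) + y \<bullet> (S *\<^sub>v y) > 0"
    using ne pos[OF xy(1)] pos[OF xy(2)] nn[OF xy(1)] nn[OF xy(2)] by linarith
  ultimately have "b = 0" by simp
  then have "B *\<^sub>v x = a \<cdot>\<^sub>v (S *\<^sub>v x)" "B *\<^sub>v y = a \<cdot>\<^sub>v (S *\<^sub>v y)"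
    unfolding Bx By using Sxy by (auto intro!: eq_vecI)
  with ne xy show ?thesis using that by blast
qed

section \<open>Splitting off a plane, and the inductive reduction\<close>

lemma mult_mat_zero_vec:
  fixes A :: "'a :: semiring_0 mat"
  shows "A \<in> carrier_mat m n \<Longrightarrow> A *\<^sub>v 0\<^sub>v n = 0\<^sub>v m"
  by (intro eq_vecI) auto

text \<open>\<open>obtain_mat_first_column\<close> is applied to \<open>v\<close>, then to the
  remaining coordinates of \<open>u\<close>. This fixes the second column only up to a multiple of
  \<open>v\<close>, which is harmless when \<open>v\<close> is in the kernel of
  \<open>S\<close>.\<close>

lemma obtain_mat_two_columns:
  fixes u v :: "real vec"
  assumes v: "v \<in> carrier_vec n" "v \<noteq> 0\<^sub>v n" and u: "u \<in> carrier_vec n"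
    and indep: "\<And>\<alpha>. u \<noteq> \<alpha> \<cdot>\<^sub>v v"
  obtains P m \<alpha> where "n = 2 + m" "P \<in> carrier_mat n n" "det P \<noteq> 0"
    "P *\<^sub>v unit_vec n 0 = v" "P *\<^sub>v unit_vec n 1 = u + \<alpha> \<cdot>\<^sub>v v"
proof -
  obtain P1 where P1: "P1 \<in> carrier_mat n n" "det P1 \<noteq> 0" "P1 *\<^sub>v unit_vec n 0 = v"
    using obtain_mat_first_column[OF v] by metis
  obtain R where R: "R \<in> carrier_mat n n" "P1 * R = 1\<^sub>m n"
    using obtain_inverse_mat[OF P1(1,2)] by metis
  have "n \<noteq> 0" using v by auto
  then obtain k where k: "n = Suc k" by (cases n) auto
  define r where "r = R *\<^sub>v u"
  have r: "r \<in> carrier_vec n" using R u by (auto simp: r_def)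
  have Pr: "P1 *\<^sub>v r = u"
    unfolding r_def using assoc_mult_mat_vec[OF P1(1) R(1) u] R(2) u by simp
  \<comment> \<open>The coordinates of \<open>u\<close> modulo \<open>v\<close>; dropping
    \<open>r $ 0\<close> is what produces the multiple of \<open>v\<close>.\<close>
  define w where "w = vec k (\<lambda>i. r $ Suc i)"
  have w: "w \<in> carrier_vec k" by (simp add: w_def)
  have append: "0\<^sub>v 1 @\<^sub>v w = r + (- r $ 0) \<cdot>\<^sub>v unit_vec n 0"
  proof (rule eq_vecI)
    fix i assume "i < dim_vec (r + (- r $ 0) \<cdot>\<^sub>v unit_vec n 0)"
    then have "i < n" using r by simp
    then show "(0\<^sub>v 1 @\<^sub>v w) $ i = (r + (- r $ 0) \<cdot>\<^sub>v unit_vec n 0) $ i"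
      using r k by (cases i) (auto simp: w_def)
  qed (use r k in \<open>auto simp: w_def\<close>)
  have P1w: "P1 *\<^sub>v (0\<^sub>v 1 @\<^sub>v w) = u + (- r $ 0) \<cdot>\<^sub>v v"
    unfolding append using P1 r
    by (simp add: mult_add_distrib_mat_vec[of _ n n] mult_mat_vec[of _ n n] Pr)
  have "w \<noteq> 0\<^sub>v k"
  proof
    assume "w = 0\<^sub>v k"
    then have "0\<^sub>v 1 @\<^sub>v w = 0\<^sub>v n" using k by auto
    then have eq: "0\<^sub>v n = u + (- r $ 0) \<cdot>\<^sub>v v"
      using P1w P1 by (simp add: mult_mat_zero_vec[of _ n n])
    have "u $ i - r $ 0 * v $ i = 0" if "i < n" for i
      using arg_cong[OF eq, of "\<lambda>x. x $ i"] that u v by simp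
    then have "u = (r $ 0) \<cdot>\<^sub>v v" using u v by (intro eq_vecI) auto
    with indep show False by blast
  qed
  then obtain P' where P': "P' \<in> carrier_mat k k" "det P' \<noteq> 0" "P' *\<^sub>v unit_vec k 0 = w"
    using obtain_mat_first_column[OF w] by metis
  have "k \<noteq> 0" using w \<open>w \<noteq> 0\<^sub>v k\<close> by auto
  then obtain m where m: "k = Suc m" by (cases k) auto
  define P2 where "P2 = four_block_mat (1\<^sub>m 1) (0\<^sub>m 1 k) (0\<^sub>m k 1) P'"
  have P2: "P2 \<in> carrier_mat n n" "det P2 \<noteq> 0"
    using P' k det_block_diag[OF P'(1), of 1] by (auto simp: P2_def)
  have unit0: "unit_vec n 0 = unit_vec 1 0 @\<^sub>v 0\<^sub>v k" and unit1: "unit_vec n 1 = 0\<^sub>v 1 @\<^sub>v unit_vec k 0"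
    using k by (auto simp: unit_vec_def intro!: eq_vecI)
  have P2_append: "P2 *\<^sub>v (s @\<^sub>v t) = s @\<^sub>v (P' *\<^sub>v t)"
    if "s \<in> carrier_vec 1" "t \<in> carrier_vec k" for s t
    unfolding P2_def using P' that
    by (subst four_block_mat_mult_vec[of _ 1 1 _ k _ k]) auto
  have "P2 *\<^sub>v unit_vec n 0 = unit_vec n 0"
    unfolding unit0 P2_append[OF unit_vec_carrier zero_carrier_vec] mult_mat_zero_vec[OF P'(1)] ..
  moreover have "P2 *\<^sub>v unit_vec n 1 = 0\<^sub>v 1 @\<^sub>v w"
    unfolding unit1 P2_append[OF zero_carrier_vec unit_vec_carrier] P'(3) ..
  ultimately have "(P1 * P2) *\<^sub>v unit_vec n 0 = v" "(P1 * P2) *\<^sub>v unit_vec n 1 = u + (- r $ 0) \<cdot>\<^sub>v v"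
    using P1 P2 P1w by (simp_all add: assoc_mult_mat_vec[of _ n n _ n])
  then show ?thesis
    using that[of m "P1 * P2" "- r $ 0"] k m P1 P2 by (auto simp: det_mult[of _ n])
qed

text \<open>In a basis starting with \<open>v\<close> and \<open>u\<close> (modulo
  \<open>v\<close>), the leading block of \<open>B\<close> is invertible and determines
  \<open>X\<close> by back-substitution. The same \<open>X\<close> serves \<open>S\<close>: its row
  0 vanishes, and its row 1 is row 0 of \<open>B\<close> because
  \<open>S *\<^sub>v u = B *\<^sub>v v\<close>. The block of \<open>S\<close> is singular since it
  kills the direction of \<open>v\<close>.\<close>

lemma split_pencil_plane:
  assumes S: "pos_semidef n S" and B: "B \<in> Sym n"
    and v: "v \<in> carrier_vec n" "S *\<^sub>v v = 0\<^sub>v n" "v \<bullet> (B *\<^sub>v v) = 0" "B *\<^sub>v v \<noteq> 0\<^sub>v n"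
    and u: "u \<in> carrier_vec n" "S *\<^sub>v u = B *\<^sub>v v"
  obtains m Q C D S' B' where "n = 2 + m" "Q \<in> carrier_mat n n" "det Q \<noteq> 0" "S' \<in> Sym m" "B' \<in> Sym m"
    "C \<in> carrier_mat 2 2" "D \<in> carrier_mat 2 2" "det C = 0"
    "congr Q S = four_block_mat C (0\<^sub>m 2 m) (0\<^sub>m m 2) S'"
    "congr Q B = four_block_mat D (0\<^sub>m 2 m) (0\<^sub>m m 2) B'"
proof -
  have SS: "S \<in> Sym n" using S by (simp add: pos_semidef_def)
  note Sc = SymD(1)[OF SS] and Bc = SymD(1)[OF B]
  have v0: "v \<noteq> 0\<^sub>v n" using v(4) Bc by (auto simp: mult_mat_zero_vec[of _ n n])
  have "u \<noteq> \<alpha> \<cdot>\<^sub>v v" for \<alpha>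
  proof
    assume "u = \<alpha> \<cdot>\<^sub>v v"
    then have "S *\<^sub>v u = \<alpha> \<cdot>\<^sub>v 0\<^sub>v n" using v Sc by (simp add: mult_mat_vec[of _ n n])
    also have "\<dots> = 0\<^sub>v n" by (intro eq_vecI) auto
    finally show False using u v by simp
  qed
  then obtain P m \<alpha> where n: "n = 2 + m" and P: "P \<in> carrier_mat n n" "det P \<noteq> 0"
    and P0: "P *\<^sub>v unit_vec n 0 = v" and P1: "P *\<^sub>v unit_vec n 1 = u + \<alpha> \<cdot>\<^sub>v v"
    using obtain_mat_two_columns[OF v(1) v0 u(1)] by metis
  define u' where "u' = u + \<alpha> \<cdot>\<^sub>v v"
  have u': "u' \<in> carrier_vec n" "S *\<^sub>v u' = B *\<^sub>v v"
    using u v Sc Bc by (auto simp: u'_def mult_add_distrib_mat_vec[of _ n n] mult_mat_vec[of _ n n])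
  define M N where "M = congr P S" and "N = congr P B"
  have MN: "M \<in> Sym n" "N \<in> Sym n" using congr_Sym P SS B by (auto simp: M_def N_def)
  define p where "p j = P *\<^sub>v unit_vec n j" for j
  have p: "p j \<in> carrier_vec n" for j using P by (auto simp: p_def)
  \<comment> \<open>Symmetry puts \<open>A\<close> on \<open>p i\<close>, so that row
    \<open>i\<close> is controlled by the image of \<open>p i\<close>.\<close>
  have idx: "congr P A $$ (i, j) = p j \<bullet> (A *\<^sub>v p i)" if "A \<in> Sym n" "i < n" "j < n" for A i j
    using unit_vec_quadratic[of "congr P A" n j i] SymD(1)[OF that(1)] that P Sym_index[OF congr_Sym[OF P(1) that(1)], of i j]
    by (simp add: scalar_congr_mult_vec[of _ n] p_def)
  have M0: "M $$ (0, j) = 0" if "j < n" for j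
    using idx[OF SS _ that, of 0] n P0 v(2) p by (simp add: M_def p_def)
  have M1: "M $$ (1, j) = N $$ (0, j)" if "j < n" for j
    using idx[OF SS _ that, of 1] idx[OF B _ that, of 0] n P0 P1 u'(2) by (simp add: M_def N_def p_def u'_def)
  define d where "d = N $$ (0, 1)"
  have N01: "N $$ (1, 0) = d" using Sym_index[OF MN(2)] n by (simp add: d_def)
  have N00: "N $$ (0, 0) = 0" using idx[OF B, of 0 0] n P0 v(3) by (simp add: N_def p_def)
  have "d = u' \<bullet> (S *\<^sub>v u')"
    using idx[OF B, of 0 1] n P0 P1 u'(2) by (simp add: d_def N_def p_def u'_def)
  \<comment> \<open>If \<open>d\<close> were zero, \<open>u'\<close> would lie in the kernel of
    \<open>S\<close>, contradicting \<open>B *\<^sub>v v \<noteq> 0\<^sub>v n\<close>.\<close>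
  then have d: "d \<noteq> 0" using pos_semidef_kernel[OF S u'(1)] u'(2) v(4) by auto
  \<comment> \<open>The leading \<open>2 \<times> 2\<close> blocks are \<open>[0, 0; 0, d]\<close> for \<open>M\<close> and \<open>[0, d; d, *]\<close> for \<open>N\<close>, and row 1 of \<open>M\<close> is row 0 of \<open>N\<close>.\<close>
  define X where "X = mat 2 m (\<lambda>(i, j). if i = 0
      then (N $$ (1, 2 + j) - N $$ (1, 1) * N $$ (0, 2 + j) / d) / d else N $$ (0, 2 + j) / d)"
  have X: "X \<in> carrier_mat 2 m" by (simp add: X_def)
  have two: "i = 0 \<or> i = 1" if "i < 2" for i :: nat using that by auto
  have "(\<Sum>l<2. M $$ (i, l) * X $$ (l, j)) = M $$ (i, 2 + j)"
    and "(\<Sum>l<2. N $$ (i, l) * X $$ (l, j)) = N $$ (i, 2 + j)" if "i < 2" "j < m" for i j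
    using two[OF that(1)] that(2) n d N01 N00 M0 M1 d_def
    by (auto simp: X_def numeral_2_eq_2 field_simps)
  from split_pencil[OF MN n X this]
  obtain Q S' B' where Q: "Q \<in> carrier_mat n n" "det Q \<noteq> 0" "S' \<in> Sym m" "B' \<in> Sym m"
    "congr Q M = four_block_mat (mat 2 2 (\<lambda>ij. M $$ ij)) (0\<^sub>m 2 m) (0\<^sub>m m 2) S'"
    "congr Q N = four_block_mat (mat 2 2 (\<lambda>ij. N $$ ij)) (0\<^sub>m 2 m) (0\<^sub>m m 2) B'"
    by metis
  have "det (mat 2 2 (\<lambda>ij. M $$ ij)) = 0"
  proof -
    have "mat 2 2 (\<lambda>ij. M $$ ij) *\<^sub>v unit_vec 2 0 = 0\<^sub>v 2"
      using M0 Sym_index[OF MN(1), of _ 0] n by (intro eq_vecI) (auto simp: scalar_prod_right_unit)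
    moreover have "unit_vec 2 0 \<noteq> (0\<^sub>v 2 :: real vec)" by (simp add: unit_vec_nonzero)
    ultimately show ?thesis
      using det_0_iff_vec_prod_zero[of "mat 2 2 (\<lambda>ij. M $$ ij)" 2] by (metis mat_carrier unit_vec_carrier)
  qed
  with Q P Sc Bc n show ?thesis
    by (intro that[of m "P * Q" S' B' "mat 2 2 (\<lambda>ij. M $$ ij)" "mat 2 2 (\<lambda>ij. N $$ ij)"])
      (auto simp: det_mult[of _ n] congr_mult[of _ n, symmetric] M_def N_def)
qed

text \<open>The normal form stated for \<open>(S, B)\<close> with \<open>S\<close> semi-definite:
  once \<open>A\<close> is written as \<open>s \<cdot>\<^sub>m S + l \<cdot>\<^sub>m B\<close>,
  \<open>det C = 0\<close> becomes the condition that \<open>l\<close> is a generalized eigenvalue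
  of the block.\<close>

definition reducible_pencil :: "nat \<Rightarrow> real mat \<Rightarrow> real mat \<Rightarrow> bool" where
  "reducible_pencil n S B \<longleftrightarrow> (\<exists>Q bs. Q \<in> carrier_mat n n \<and> det Q \<noteq> 0 \<and>
     block_diagonal_pencil (congr Q S) (congr Q B) bs \<and>
     (\<forall>(C, D) \<in> set bs. dim_row C \<le> 2 \<and> (dim_row C = 2 \<longrightarrow> det C = 0)))"

text \<open>Inductive step shared by lines and planes: the reduction \<open>R\<close> of the
  remaining pencil is extended by an identity block and composed with \<open>Q\<close>.\<close>

lemma reducible_pencil_split:
  assumes c: "S \<in> carrier_mat n n" "B \<in> carrier_mat n n" and n: "n = k + m" and k: "k > 0" "k \<le> 2"
    and Q: "Q \<in> carrier_mat n n" "det Q \<noteq> 0"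
    and CD: "C \<in> carrier_mat k k" "D \<in> carrier_mat k k" "k = 2 \<Longrightarrow> det C = 0"
    and SB': "S' \<in> carrier_mat m m" "B' \<in> carrier_mat m m"
    and QS: "congr Q S = four_block_mat C (0\<^sub>m k m) (0\<^sub>m m k) S'"
    and QB: "congr Q B = four_block_mat D (0\<^sub>m k m) (0\<^sub>m m k) B'"
    and red: "reducible_pencil m S' B'"
  shows "reducible_pencil n S B"
proof -
  obtain R bs where R: "R \<in> carrier_mat m m" "det R \<noteq> 0"
    and bs: "block_diagonal_pencil (congr R S') (congr R B') bs"
    "\<forall>(C, D) \<in> set bs. dim_row C \<le> 2 \<and> (dim_row C = 2 \<longrightarrow> det C = 0)"
    using red unfolding reducible_pencil_def by blast
  define T where "T = four_block_mat (1\<^sub>m k) (0\<^sub>m k m) (0\<^sub>m m k) R"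
  have T: "T \<in> carrier_mat n n" "det T \<noteq> 0"
    using R n det_block_diag[OF R(1), of k] by (auto simp: T_def)
  have eq: "congr (Q * T) S = four_block_mat C (0\<^sub>m k m) (0\<^sub>m m k) (congr R S')"
    "congr (Q * T) B = four_block_mat D (0\<^sub>m k m) (0\<^sub>m m k) (congr R B')"
    using congr_mult[OF Q(1) T(1) c(1)] congr_mult[OF Q(1) T(1) c(2)] QS QB
      congr_block_diag[OF CD(1) SB'(1) R(1)] congr_block_diag[OF CD(2) SB'(2) R(1)]
    by (simp_all add: T_def)
  have d: "diag_block_mat (map fst bs) = congr R S'" "diag_block_mat (map snd bs) = congr R B'"
    and dims: "\<forall>(C, D) \<in> set bs. \<exists>d>0. C \<in> carrier_mat d d \<and> D \<in> carrier_mat d d"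
    using bs(1) by (simp_all add: block_diagonal_pencil_def)
  have "congr R S' \<in> carrier_mat m m" "congr R B' \<in> carrier_mat m m" using R SB' by auto
  then have "block_diagonal_pencil (congr (Q * T) S) (congr (Q * T) B) ((C, D) # bs)"
    using dims CD k unfolding block_diagonal_pencil_def
    by (auto simp: eq Let_def d)
  then show ?thesis unfolding reducible_pencil_def
    using Q T bs(2) CD k by (intro exI[of _ "Q * T"] exI[of _ "(C, D) # bs"]) (auto simp: det_mult[of _ n])
qed

text \<open>Strong induction, since a step removes one or two dimensions; the remaining block of
  \<open>S\<close> stays semi-definite.\<close>

lemma pos_semidef_pencil_reducible:
  assumes "pos_semidef n S" "B \<in> Sym n"
  shows "reducible_pencil n S B"
  using assms
proof (induction n arbitrary: S B rule: less_induct)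
  case (less n)
  note S = less.prems(1) and B = less.prems(2)
  have SS: "S \<in> Sym n" using S by (simp add: pos_semidef_def)
  note Sc = SymD(1)[OF SS] and Bc = SymD(1)[OF B]
  \<comment> \<open>Covers cases (a), (b) and (d) below, with different \<open>y\<close> and
    factors.\<close>
  have line: "reducible_pencil n S B"
    if v: "v \<in> carrier_vec n" and y: "y \<in> carrier_vec n" "v \<bullet> y \<noteq> 0"
      and Sv: "S *\<^sub>v v = \<alpha> \<cdot>\<^sub>v y" "B *\<^sub>v v = \<beta> \<cdot>\<^sub>v y" for v y \<alpha> \<beta>
  proof -
    have "n \<noteq> 0" using y by (intro notI) (simp add: scalar_prod_def)
    then obtain m where n: "n = Suc m" by (cases n) auto
    obtain Q C D S' B' where Q: "Q \<in> carrier_mat n n" "det Q \<noteq> 0" "S' \<in> Sym m" "B' \<in> Sym m"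
      "C \<in> carrier_mat 1 1" "D \<in> carrier_mat 1 1"
      "congr Q S = four_block_mat C (0\<^sub>m 1 m) (0\<^sub>m m 1) S'"
      "congr Q B = four_block_mat D (0\<^sub>m 1 m) (0\<^sub>m m 1) B'"
      using split_pencil_line[OF SS B n v y Sv] by metis
    have n1: "n = 1 + m" using n by simp
    have "pos_semidef m S'"
      by (rule pos_semidef_lower_block[of 1 m C])
        (use congr_pos_semidef[OF Q(1) S] Q n1 in simp_all)
    then have "reducible_pencil m S' B'" using less.IH[of m] Q(4) n by simp
    then show ?thesis
      using reducible_pencil_split[OF Sc Bc n1 _ _ Q(1,2,5,6) _ _ _ Q(7,8)] SymD(1) Q(3,4) by auto
  qed
  show ?case
  proof (cases "n = 0")
    case True
    then have "congr (1\<^sub>m 0) S = 0\<^sub>m 0 0" "congr (1\<^sub>m 0) B = 0\<^sub>m 0 0" using Sc Bc by auto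
    then show ?thesis unfolding reducible_pencil_def block_diagonal_pencil_def
      using True by (intro exI[of _ "1\<^sub>m 0"] exI[of _ "[]"]) auto
  next
    case n: False
    \<comment> \<open>If (d) fails, a nonzero kernel vector of \<open>S\<close> falls under (b) when
      \<open>B\<close> kills it, and otherwise under (c), unless (a) holds for some vector.\<close>
    consider (a) v where "v \<in> carrier_vec n" "S *\<^sub>v v = 0\<^sub>v n" "v \<bullet> (B *\<^sub>v v) \<noteq> 0"
      | (b) v where "v \<in> carrier_vec n" "v \<noteq> 0\<^sub>v n" "S *\<^sub>v v = 0\<^sub>v n" "B *\<^sub>v v = 0\<^sub>v n"
      | (c) v where "v \<in> carrier_vec n" "S *\<^sub>v v = 0\<^sub>v n" "B *\<^sub>v v \<noteq> 0\<^sub>v n"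
          "\<And>v. v \<in> carrier_vec n \<Longrightarrow> S *\<^sub>v v = 0\<^sub>v n \<Longrightarrow> v \<bullet> (B *\<^sub>v v) = 0"
      | (d) "\<And>v. v \<in> carrier_vec n \<Longrightarrow> v \<noteq> 0\<^sub>v n \<Longrightarrow> S *\<^sub>v v \<noteq> 0\<^sub>v n"
      by metis
    then show ?thesis
    proof cases
      case a
      have "B *\<^sub>v v \<in> carrier_vec n" using Bc a by auto
      then show ?thesis using a
        by (intro line[of v "B *\<^sub>v v" 0 1]) (use Bc in \<open>auto intro!: eq_vecI\<close>)
    next
      case b
      then show ?thesis using scalar_prod_self_pos[OF b(1,2)]
        by (intro line[of v v 0 0]) (auto intro!: eq_vecI)
    next
      case c
      define y where "y = B *\<^sub>v v"
      have y: "y \<in> carrier_vec n" using Bc c by (auto simp: y_def)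
      \<comment> \<open>Polarization: a quadratic form vanishing on the kernel of \<open>S\<close>
        also vanishes there as a bilinear form.\<close>
      have "w \<bullet> y = 0" if w: "w \<in> carrier_vec n" "S *\<^sub>v w = 0\<^sub>v n" for w
      proof -
        have "S *\<^sub>v (w + v) = 0\<^sub>v n" using w c Sc by (simp add: mult_add_distrib_mat_vec[of _ n n])
        then have "0 = (w + v) \<bullet> (B *\<^sub>v (w + v))" using c(4)[of "w + v"] w c by simp
        also have "\<dots> = w \<bullet> (B *\<^sub>v w) + w \<bullet> y + (v \<bullet> (B *\<^sub>v w) + v \<bullet> (B *\<^sub>v v))"
          using w c Bc by (simp add: y_def mult_add_distrib_mat_vec[of _ n n]
              add_scalar_prod_distrib[of _ n] scalar_prod_add_distrib[of _ n])
        also have "\<dots> = 2 * (w \<bullet> y)"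
          using c(4)[OF w] c(4)[OF c(1,2)] scalar_Sym_comm[OF B w(1) c(1)] by (simp add: y_def)
        finally show ?thesis by simp
      qed
      \<comment> \<open>Being orthogonal to the kernel of \<open>S\<close>, the vector
        \<open>y\<close> lies in its range.\<close>
      then obtain u where u: "u \<in> carrier_vec n" "S *\<^sub>v u = B *\<^sub>v v"
        using pos_semidef_range[OF S y] by (metis y_def)
      obtain m Q C D S' B' where n2: "n = 2 + m"
        and Q: "Q \<in> carrier_mat n n" "det Q \<noteq> 0" "S' \<in> Sym m" "B' \<in> Sym m"
        "C \<in> carrier_mat 2 2" "D \<in> carrier_mat 2 2" "det C = 0"
        "congr Q S = four_block_mat C (0\<^sub>m 2 m) (0\<^sub>m m 2) S'"
        "congr Q B = four_block_mat D (0\<^sub>m 2 m) (0\<^sub>m m 2) B'"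
        using split_pencil_plane[OF S B c(1,2) c(4)[OF c(1,2)] c(3) u] by metis
      have "pos_semidef m S'"
        by (rule pos_semidef_lower_block[of 2 m C])
          (use congr_pos_semidef[OF Q(1) S] Q n2 in simp_all)
      then have "reducible_pencil m S' B'" using less.IH[of m] Q(4) n2 by simp
      then show ?thesis
        using reducible_pencil_split[OF Sc Bc n2 _ _ Q(1,2,5,6,7) _ _ Q(8,9)] SymD(1) Q(3,4) by auto
    next
      case d
      have "v \<bullet> (S *\<^sub>v v) > 0" if "v \<in> carrier_vec n" "v \<noteq> 0\<^sub>v n" for v
        using S d[OF that] pos_semidef_kernel[OF S that(1)] that(1)
        unfolding pos_semidef_def by (metis order_le_less)
      then have pd: "pos_def n S" using SS by (simp add: pos_def_def)
      from pos_def_pencil_eigenvector[OF pd B] n obtain v \<mu> where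
        v: "v \<in> carrier_vec n" "v \<noteq> 0\<^sub>v n" "B *\<^sub>v v = \<mu> \<cdot>\<^sub>v (S *\<^sub>v v)" by blast
      have "v \<bullet> (S *\<^sub>v v) > 0" using pd v by (simp add: pos_def_def)
      then show ?thesis using v Sc
        by (intro line[of v "S *\<^sub>v v" 1 \<mu>]) auto
    qed
  qed
qed

section \<open>The normal form\<close>

lemma congruent_pencil_iff:
  assumes "A \<in> carrier_mat n n" "B \<in> carrier_mat n n"
  shows "congruent_pencil n A B A' B' \<longleftrightarrow>
    (\<exists>Q \<in> carrier_mat n n. det Q \<noteq> 0 \<and> A' = congr Q A \<and> B' = congr Q B)"
  unfolding congruent_pencil_def congr_def using invertible_mat_iff_det by blast

text \<open>Congruence is linear, so the same coefficients serve on both sides.\<close>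

lemma semidef_pencil_congr:
  assumes Q: "Q \<in> carrier_mat n n" "det Q \<noteq> 0" and AB: "A \<in> carrier_mat n n" "B \<in> carrier_mat n n"
    and sd: "semidef_pencil n (congr Q A) (congr Q B)"
  shows "semidef_pencil n A B"
proof -
  obtain c1 c2 where c: "c1 \<cdot>\<^sub>m congr Q A + c2 \<cdot>\<^sub>m congr Q B \<noteq> 0\<^sub>m n n"
    "pos_semidef n (c1 \<cdot>\<^sub>m congr Q A + c2 \<cdot>\<^sub>m congr Q B)"
    using sd unfolding semidef_pencil_def by auto
  define C where "C = c1 \<cdot>\<^sub>m A + c2 \<cdot>\<^sub>m B"
  have C: "C \<in> carrier_mat n n" using AB by (auto simp: C_def)
  have "c1 \<cdot>\<^sub>m congr Q A + c2 \<cdot>\<^sub>m congr Q B = congr Q C"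
    unfolding C_def using Q AB by (simp add: congr_add[of _ n] congr_smult[of _ n])
  with c have "congr Q C \<noteq> 0\<^sub>m n n" "pos_semidef n C"
    using congr_pos_semidef_iff[OF Q C] by simp_all
  then have "C \<noteq> 0\<^sub>m n n \<and> pos_semidef n C" using Q by auto
  then show ?thesis unfolding semidef_pencil_def C_def by blast
qed

section \<open>Linear combinations of pencils and of their blocks\<close>

lemma smult_mat_eq_zero_iff:
  fixes A :: "'a :: field mat"
  assumes A: "A \<in> carrier_mat m n" and a: "a \<noteq> 0"
  shows "a \<cdot>\<^sub>m A = 0\<^sub>m m n \<longleftrightarrow> A = 0\<^sub>m m n"
proof
  assume 0: "a \<cdot>\<^sub>m A = 0\<^sub>m m n"
  have "A $$ (i, j) = 0" if "i < m" "j < n" for i j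
    using arg_cong[OF 0, of "\<lambda>M. M $$ (i, j)"] that A a by simp
  then show "A = 0\<^sub>m m n" using A by (intro eq_matI) auto
qed auto

lemma uminus_mat_eq_smult:
  fixes A :: "'a :: ring_1 mat"
  shows "- A = (- 1) \<cdot>\<^sub>m A"
  by (intro eq_matI) auto

text \<open>The coefficients are \<open>(1, - l)\<close> or \<open>(- 1, l)\<close>, according to
  the sign of the semi-definite matrix.\<close>

lemma semidef_pencil_if_semidef_diff:
  assumes AB: "A \<in> carrier_mat n n" "B \<in> carrier_mat n n"
    and "A - l \<cdot>\<^sub>m B \<noteq> 0\<^sub>m n n" "semidef n (A - l \<cdot>\<^sub>m B)"
  shows "semidef_pencil n A B"
proof -
  have 1: "A - l \<cdot>\<^sub>m B = 1 \<cdot>\<^sub>m A + (- l) \<cdot>\<^sub>m B"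
    and 2: "- (A - l \<cdot>\<^sub>m B) = (- 1) \<cdot>\<^sub>m A + l \<cdot>\<^sub>m B"
    using AB by (auto intro!: eq_matI)
  have "- (A - l \<cdot>\<^sub>m B) \<noteq> 0\<^sub>m n n"
    unfolding uminus_mat_eq_smult using assms(3) AB
    by (subst smult_mat_eq_zero_iff) (auto intro!: minus_carrier_mat)
  with assms(3,4) show ?thesis
    unfolding semidef_pencil_def semidef_def by (metis 1 2)
qed

lemma pos_semidef_smult:
  assumes A: "pos_semidef n A" and c: "c \<ge> 0"
  shows "pos_semidef n (c \<cdot>\<^sub>m A)"
proof -
  have S: "A \<in> Sym n" using A by (simp add: pos_semidef_def)
  note Ac = SymD(1)[OF S]
  have "c \<cdot>\<^sub>m A \<in> Sym n" using Ac Sym_index[OF S] by (intro SymI) auto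
  moreover have "v \<bullet> ((c \<cdot>\<^sub>m A) *\<^sub>v v) = c * (v \<bullet> (A *\<^sub>v v))" if "v \<in> carrier_vec n" for v
    using that Ac by (simp add: smult_mat_mult_vec[of _ n n])
  ultimately show ?thesis using A c by (simp add: pos_semidef_def)
qed

text \<open>The common size in the second conjunct is carried through the induction so that the
  tails can be compared entry by entry.\<close>

lemma diag_block_mat_lincomb:
  fixes bs :: "(real mat \<times> real mat) list"
  assumes "\<forall>(C, D) \<in> set bs. \<exists>d. C \<in> carrier_mat d d \<and> D \<in> carrier_mat d d"
  shows "diag_block_mat (map (\<lambda>(C, D). a \<cdot>\<^sub>m C + b \<cdot>\<^sub>m D) bs) =
    a \<cdot>\<^sub>m diag_block_mat (map fst bs) + b \<cdot>\<^sub>m diag_block_mat (map snd bs) \<and>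
    (\<exists>m. diag_block_mat (map fst bs) \<in> carrier_mat m m \<and> diag_block_mat (map snd bs) \<in> carrier_mat m m)"
  using assms
proof (induction bs)
  case Nil
  then show ?case by (auto intro: exI[of _ 0])
next
  case (Cons CD bs)
  obtain C D where CD: "CD = (C, D)" by fastforce
  obtain d where d: "C \<in> carrier_mat d d" "D \<in> carrier_mat d d" using Cons.prems CD by auto
  obtain m where m: "diag_block_mat (map fst bs) \<in> carrier_mat m m"
    "diag_block_mat (map snd bs) \<in> carrier_mat m m"
    and IH: "diag_block_mat (map (\<lambda>(C, D). a \<cdot>\<^sub>m C + b \<cdot>\<^sub>m D) bs) =
      a \<cdot>\<^sub>m diag_block_mat (map fst bs) + b \<cdot>\<^sub>m diag_block_mat (map snd bs)"
    using Cons by auto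
  have "diag_block_mat (map fst (CD # bs)) \<in> carrier_mat (d + m) (d + m)"
    "diag_block_mat (map snd (CD # bs)) \<in> carrier_mat (d + m) (d + m)"
    using d m by (auto simp: CD Let_def)
  moreover have "diag_block_mat (map (\<lambda>(C, D). a \<cdot>\<^sub>m C + b \<cdot>\<^sub>m D) (CD # bs)) =
    a \<cdot>\<^sub>m diag_block_mat (map fst (CD # bs)) + b \<cdot>\<^sub>m diag_block_mat (map snd (CD # bs))"
    using d m by (intro eq_matI) (auto simp: CD IH Let_def)
  ultimately show ?case by blast
qed

text \<open>The reduction is carried out for \<open>(S, B)\<close> and translated back to
  \<open>(A, B)\<close> block by block; \<open>l\<close> depends only on the coefficients of
  \<open>S\<close>, hence is common to all blocks.\<close>

lemma semidef_pencil_normal_form: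
  assumes A: "is_hyperplane n A" and B: "is_hyperplane n B" and sd: "semidef_pencil n A B"
  shows "\<exists>A' B' bs l. congruent_pencil n A B A' B' \<and> block_diagonal_pencil A' B' bs \<and>
    (\<forall>(C, D) \<in> set bs. dim_row C \<le> 2) \<and>
    (\<forall>(C, D) \<in> set bs. dim_row C = 2 \<longrightarrow> gen_eigenvalue C D l) \<and>
    A' - l \<cdot>\<^sub>m B' \<noteq> 0\<^sub>m n n \<and> semidef n (A' - l \<cdot>\<^sub>m B')"
proof -
  have c: "A \<in> carrier_mat n n" "B \<in> carrier_mat n n" and BS: "B \<in> Sym n"
    using A B SymD by (auto simp: is_hyperplane_def)
  obtain c1 c2 where C: "c1 \<cdot>\<^sub>m A + c2 \<cdot>\<^sub>m B \<noteq> 0\<^sub>m n n" "pos_semidef n (c1 \<cdot>\<^sub>m A + c2 \<cdot>\<^sub>m B)"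
    using sd unfolding semidef_pencil_def by auto
  define S where "S = c1 \<cdot>\<^sub>m A + c2 \<cdot>\<^sub>m B"
  have S: "pos_semidef n S" "S \<noteq> 0\<^sub>m n n" "S \<in> carrier_mat n n" using C c by (auto simp: S_def)
  \<comment> \<open>Otherwise \<open>S\<close> is a multiple of \<open>B\<close> and has zero trace
    against a point of \<open>perp n B\<close>, contradicting
    \<open>trace_pos_def_pos_semidef\<close>.\<close>
  have c1: "c1 \<noteq> 0"
  proof
    assume "c1 = 0"
    obtain X where X: "X \<in> perp n B" using B by (auto simp: is_hyperplane_def)
    then have Xp: "pos_def n X" "X \<in> carrier_mat n n" using SymD by (auto simp: perp_def P_space_def)
    show False
      using trace_pos_def_pos_semidef[OF Xp(1) S(1,2)] trace_mat_mult_lincomb[OF Xp(2) c, of c1 c2] X \<open>c1 = 0\<close>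
      by (simp add: S_def perp_def)
  qed
  \<comment> \<open>From solving \<open>S = c1 \<cdot>\<^sub>m A + c2 \<cdot>\<^sub>m B\<close> for
    \<open>A\<close>.\<close>
  define l s where "l = - c2 / c1" and "s = 1 / c1"
  have s: "s \<noteq> 0" using c1 by (simp add: s_def)
  have A_eq: "A = s \<cdot>\<^sub>m S + l \<cdot>\<^sub>m B"
    using c c1 by (intro eq_matI) (auto simp: S_def s_def l_def field_simps)
  obtain Q bs where Q: "Q \<in> carrier_mat n n" "det Q \<noteq> 0"
    and bs: "block_diagonal_pencil (congr Q S) (congr Q B) bs"
    and small: "\<forall>(C, D) \<in> set bs. dim_row C \<le> 2 \<and> (dim_row C = 2 \<longrightarrow> det C = 0)"
    using pos_semidef_pencil_reducible[OF S(1) BS] unfolding reducible_pencil_def by blast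
  define S' B' where "S' = congr Q S" and "B' = congr Q B"
  have c': "S' \<in> carrier_mat n n" "B' \<in> carrier_mat n n" using Q S c by (auto simp: S'_def B'_def)
  have A': "congr Q A = s \<cdot>\<^sub>m S' + l \<cdot>\<^sub>m B'"
    unfolding S'_def B'_def using Q S c by (subst A_eq) (simp add: congr_add[of _ n] congr_smult[of _ n])
  define bs' where "bs' = map (\<lambda>(C, D). (s \<cdot>\<^sub>m C + l \<cdot>\<^sub>m D, D)) bs"
  have dims: "\<forall>(C, D) \<in> set bs. \<exists>d>0. C \<in> carrier_mat d d \<and> D \<in> carrier_mat d d"
    and S'_eq: "S' = diag_block_mat (map fst bs)" and B'_eq: "B' = diag_block_mat (map snd bs)"
    using bs by (simp_all add: block_diagonal_pencil_def S'_def B'_def)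
  have map: "map fst bs' = map (\<lambda>(C, D). s \<cdot>\<^sub>m C + l \<cdot>\<^sub>m D) bs" "map snd bs' = map snd bs"
    by (auto simp: bs'_def)
  have blk: "\<exists>d>0. s \<cdot>\<^sub>m C + l \<cdot>\<^sub>m D \<in> carrier_mat d d \<and> D \<in> carrier_mat d d" "dim_row D \<le> 2"
    if CD: "(C, D) \<in> set bs" for C D
  proof -
    obtain d where d: "d > 0" "C \<in> carrier_mat d d" "D \<in> carrier_mat d d" using dims CD by blast
    then have "s \<cdot>\<^sub>m C + l \<cdot>\<^sub>m D \<in> carrier_mat d d" by auto
    with d show "\<exists>d>0. s \<cdot>\<^sub>m C + l \<cdot>\<^sub>m D \<in> carrier_mat d d \<and> D \<in> carrier_mat d d" by blast
    show "dim_row D \<le> 2" using small CD d by auto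
  qed
  have "congr Q A = diag_block_mat (map fst bs')"
    unfolding A' map S'_eq B'_eq
    by (rule conjunct1[OF diag_block_mat_lincomb, symmetric]) (use dims in blast)
  moreover have "B' = diag_block_mat (map snd bs')" unfolding map by (rule B'_eq)
  moreover have "\<forall>(C, D) \<in> set bs'. \<exists>d>0. C \<in> carrier_mat d d \<and> D \<in> carrier_mat d d"
    using blk(1) by (auto simp: bs'_def)
  ultimately have "block_diagonal_pencil (congr Q A) B' bs'"
    unfolding block_diagonal_pencil_def by blast
  moreover have "\<forall>(C, D) \<in> set bs'. dim_row C \<le> 2"
    using blk(2) by (auto simp: bs'_def)
  moreover have "\<forall>(C, D) \<in> set bs'. dim_row C = 2 \<longrightarrow> gen_eigenvalue C D l"
  proof (intro ballI, clarify)
    fix E D assume "(E, D) \<in> set bs'" "dim_row E = 2"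
    then obtain C where C: "(C, D) \<in> set bs" "E = s \<cdot>\<^sub>m C + l \<cdot>\<^sub>m D" by (auto simp: bs'_def)
    then obtain d where d: "C \<in> carrier_mat d d" "D \<in> carrier_mat d d" using dims by blast
    then have "det C = 0" using small C \<open>dim_row E = 2\<close> by auto
    \<comment> \<open>Subtracting \<open>l\<close> times \<open>D\<close> leaves a multiple of the
      singular block \<open>C\<close>.\<close>
    moreover have "E - l \<cdot>\<^sub>m D = s \<cdot>\<^sub>m C" using d C(2) by (intro eq_matI) auto
    moreover have "d = 2" using d C(2) \<open>dim_row E = 2\<close> by auto
    ultimately show "gen_eigenvalue E D l"
      unfolding gen_eigenvalue_def using d invertible_mat_iff_det[of "s \<cdot>\<^sub>m C" d] by simp
  qed
  moreover have diff: "congr Q A - l \<cdot>\<^sub>m B' = s \<cdot>\<^sub>m S'" unfolding A' using c' by (intro eq_matI) auto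
  moreover have "s \<cdot>\<^sub>m S' \<noteq> 0\<^sub>m n n"
    using smult_mat_eq_zero_iff[OF c'(1) s] congr_eq_zeroD[OF Q S(3)] S(2) by (auto simp: S'_def)
  \<comment> \<open>The sign of \<open>s\<close> decides between positive and negative
    semi-definite.\<close>
  moreover have "semidef n (s \<cdot>\<^sub>m S')"
  proof -
    have S': "pos_semidef n S'" unfolding S'_def by (rule congr_pos_semidef[OF Q(1) S(1)])
    have "- (s \<cdot>\<^sub>m S') = (- s) \<cdot>\<^sub>m S'" using c' by (intro eq_matI) auto
    then show ?thesis
      using pos_semidef_smult[OF S', of s] pos_semidef_smult[OF S', of "- s"]
      unfolding semidef_def by (cases "s \<ge> 0") auto
  qed
  moreover have "congruent_pencil n A B (congr Q A) B'"
    unfolding congruent_pencil_iff[OF c] B'_def using Q by blast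
  ultimately show ?thesis
    by (intro exI[of _ "congr Q A"] exI[of _ B'] exI[of _ bs'] exI[of _ l]) (simp only: diff simp_thms)
qed

theorem theorem4p1:
  fixes n :: nat and A B :: "real mat"
  assumes "is_hyperplane n A" and "is_hyperplane n B"
  shows "perp n A \<inter> perp n B = {} \<longleftrightarrow>
    (\<exists>A' B'. congruent_pencil n A B A' B' \<and>
      ((diagonal_mat A' \<and> diagonal_mat B' \<and> semidef_pencil n A' B') \<or>
       (\<exists>bs. block_diagonal_pencil A' B' bs \<and>
          (\<forall>(C, D) \<in> set bs. dim_row C \<le> 2) \<and>
          (\<exists>l :: real.
             (\<forall>(C, D) \<in> set bs. dim_row C = 2 \<longrightarrow> gen_eigenvalue C D l) \<and>
             A' - l \<cdot>\<^sub>m B' \<noteq> 0\<^sub>m n n \<and> semidef n (A' - l \<cdot>\<^sub>m B')))))"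
    (is "?disjoint \<longleftrightarrow> ?normal_form")
proof
  assume ?disjoint
  from semidef_pencil_normal_form[OF assms semidef_pencil_if_perp_disjoint[OF assms this]]
  obtain A' B' bs l where "congruent_pencil n A B A' B'"
    and "block_diagonal_pencil A' B' bs" "\<forall>(C, D) \<in> set bs. dim_row C \<le> 2"
    "\<forall>(C, D) \<in> set bs. dim_row C = 2 \<longrightarrow> gen_eigenvalue C D l"
    "A' - l \<cdot>\<^sub>m B' \<noteq> 0\<^sub>m n n" "semidef n (A' - l \<cdot>\<^sub>m B')"
    by (elim exE conjE)
  then show ?normal_form by (intro exI conjI disjI2)
next
  have c: "A \<in> carrier_mat n n" "B \<in> carrier_mat n n"
    using assms SymD by (auto simp: is_hyperplane_def)
  assume ?normal_form
  then obtain A' B' where "congruent_pencil n A B A' B'" and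
    *: "semidef_pencil n A' B' \<or> (\<exists>l. A' - l \<cdot>\<^sub>m B' \<noteq> 0\<^sub>m n n \<and> semidef n (A' - l \<cdot>\<^sub>m B'))"
    by blast
  then obtain Q where Q: "Q \<in> carrier_mat n n" "det Q \<noteq> 0" and A': "A' = congr Q A" and B': "B' = congr Q B"
    using congruent_pencil_iff[OF c] by blast
  \<comment> \<open>Form (1) contains this directly; in form (2) the difference
    \<open>A' - l \<cdot>\<^sub>m B'\<close>, up to sign, is the required combination.\<close>
  have "semidef_pencil n A' B'"
    using * semidef_pencil_if_semidef_diff[of A' n B'] c Q A' B' by auto
  then show ?disjoint
    using semidef_pencil_congr[OF Q c] perp_disjoint_if_semidef_pencil[OF c] A' B' by simp
qed

end
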